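(* For all positive integers $m$ and $p$, $$\sum_{n=1}^\infty\frac{T_n(\{1\}_{2m-1})\,T_n(\{1\}_{2p-1})}{n}(-1)^n=(-1)^m\sum_{j=1}^pW(2j+2m-1,2m)\,Z(j,p).$$
   Context: $\{1\}_a$ denotes the sequence of $a$ ones. For $n\ge1$, $a\ge1$: $T_n(\{1\}_{2a-1})=\sum\frac{2^{2a-1}}{(2n_1-1)(2n_2)(2n_3-1)\cdots(2n_{2a-2})(2n_{2a-1}-1)}$, summed over integers $0<n_1\le n_2<n_3\le n_4<\cdots\le n_{2a-2}<n_{2a-1}\le n$. For positive integers $k_1,\dots,k_r$, $\bar T(k_1,\ldots,k_r):=2^r\sum_{0<n_1<\cdots<n_r}\frac{(-1)^{n_r}}{(2n_1-1)^{k_1}(2n_2-2)^{k_2}\cdots(2n_r-r)^{k_r}}$. $I(k,r)$ is the set of tuples of positive integers $(k_1,\dots,k_r)$ with sum $k$; $W(k,r):=\sum_{(k_1,\dots,k_r)\in I(k,r)}\bar T(k_1,\dots,k_r)$. $\bar\zeta(s):=\sum_{n\ge1}(-1)^{n-1}n^{-s}$ for $s\ge1$, $\bar\zeta(0):=1/2$. For $1\le j\le p$: $Z(p,p):=1$ and for $j<p$, $Z(j,p):=\sum_{k=1}^{p-j}(-2)^k\sum_{j=i_0<i_1<\cdots<i_k=p}\prod_{l=1}^k\bar\zeta(2i_l-2i_{l-1})$. *)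

theory Defs
  imports Complex_Main
begin

text \<open>T_n({1}_{2a-1}): list ns = [n_1,...,n_{2a-1}] (0-based index i stands for n_{i+1}).
  Constraints: 0 < n_1, n_{odd} \<le> n_{next}, n_{even} < n_{next}, last \<le> n.
  Denominators: 2 n_i - 1 at odd positions, 2 n_i at even positions.\<close>

definition T_chains :: "nat \<Rightarrow> nat \<Rightarrow> nat list set" where
  "T_chains n a = {ns. length ns = 2*a - 1 \<and> (\<forall>i<length ns. 0 < ns!i \<and> ns!i \<le> n) \<and>
      (\<forall>i. Suc i < length ns \<longrightarrow>
          (if even i then ns!i \<le> ns!(Suc i) else ns!i < ns!(Suc i)))}"

definition T_ones :: "nat \<Rightarrow> nat \<Rightarrow> real" where
  "T_ones n a = (\<Sum>ns\<in>T_chains n a.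
      2^(2*a - 1) / (\<Prod>i<length ns. (if even i then 2 * real (ns!i) - 1 else 2 * real (ns!i))))"

definition Tbar_inner :: "nat list \<Rightarrow> nat \<Rightarrow> real" where
  "Tbar_inner ks N = (\<Sum>ns\<in>{ns. length ns = length ks \<and> sorted_wrt (<) ns \<and>
        (\<forall>i<length ns. 0 < ns!i) \<and> ns \<noteq> [] \<and> last ns = N}.
      (-1)^N / (\<Prod>j<length ks. (2 * real (ns!j) - real (Suc j)) ^ (ks!j)))"

definition Tbar :: "nat list \<Rightarrow> real" where
  "Tbar ks = 2^(length ks) * (\<Sum>N. Tbar_inner ks N)"

definition Icomp :: "nat \<Rightarrow> nat \<Rightarrow> nat list set" where
  "Icomp k r = {ks. length ks = r \<and> (\<forall>i<r. 0 < ks!i) \<and> sum_list ks = k}"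

definition W :: "nat \<Rightarrow> nat \<Rightarrow> real" where
  "W k r = (\<Sum>ks\<in>Icomp k r. Tbar ks)"

definition zetabar :: "nat \<Rightarrow> real" where
  "zetabar s = (if s = 0 then 1/2 else (\<Sum>n. (-1)^n / (real (Suc n)) ^ s))"

definition Zchains :: "nat \<Rightarrow> nat \<Rightarrow> nat \<Rightarrow> nat list set" where
  "Zchains k j p = {is. length is = Suc k \<and> sorted_wrt (<) is \<and> is!0 = j \<and> is!k = p}"

definition Z :: "nat \<Rightarrow> nat \<Rightarrow> real" where
  "Z j p = (if j = p then 1 else
     (\<Sum>k=1..p-j. (-2)^k * (\<Sum>is\<in>Zchains k j p.
        (\<Prod>l=1..k. zetabar (2 * (is!l) - 2 * (is!(l-1)))))))"

end

theory Submission
  imports Defs "HOL-Analysis.Analysis" "HOL-Real_Asymp.Real_Asymp"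
begin

text \<open>
  Put \<open>x = (1 - s) / (1 + s)\<close>, so that \<open>2 arctan x = pi / 2 - 2 arctan s\<close> and
  \<open>ln ((1 + x) / (1 - x)) = - ln s\<close>. Both sides are related through the integral
  \<open>\<integral>\<^sub>0\<^sup>1 (- ln s) ^ q / q! * (2 arctan x) ^ r / r! * 2 / (1 + s\<^sup>2) ds\<close>
  with \<open>q = 2 j - 1\<close>, \<open>r = 2 m - 1\<close>.

  On the one hand, expanding in powers of \<open>s\<close> shows that it equals \<open>W (q + r + 1) (r + 1)\<close>. On the
  other hand, \<open>(2 arctan x) ^ r / r! / (1 + x\<^sup>2)\<close> is, up to sign, the generating function of
  \<open>(-1) ^ n T_n({1}_r)\<close>, and integration by parts gives
  \<open>\<integral>\<^sub>0\<^sup>1 2 n x ^ (2 n - 1) (- ln s) ^ q / q! dx =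
    \<Sum>i = 1..j. 2 zetabar (2 j - 2 i) T_n({1}_{2 i - 1})\<close>,
  because both sides satisfy the recursion by which the sums \<open>T_n\<close> are built up. Integrating term by
  term evaluates \<open>\<Sum>n. (-1) ^ n T_n({1}_r) / n\<close> times the right-hand side. The numbers \<open>Z j p\<close> invert
  the convolution with \<open>2 zetabar\<close>, whose generating function is \<open>pi v / sin (pi v)\<close>.
\<close>

unbundle no vec_syntax
unbundle fps_syntax

section \<open>Integrals against divided powers\<close>

lemma has_integral_Ioo_of_limits:
  fixes F f :: "real \<Rightarrow> real"
  assumes "a < b"
    and deriv: "\<And>x. x \<in> {a<..<b} \<Longrightarrow> (F has_real_derivative f x) (at x)"
    and lim_a: "(F \<longlongrightarrow> l) (at_right a)" and lim_b: "(F \<longlongrightarrow> m) (at_left b)"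
  shows "(f has_integral (m - l)) {a<..<b}"
proof -
  define G where "G x = (if x \<le> a then l else if b \<le> x then m else F x)" for x
  have G_eq_F: "G x = F x" if "x \<in> {a<..<b}" for x
    using that by (simp add: G_def)
  have deriv_G: "(G has_real_derivative f x) (at x)" if "x \<in> {a<..<b}" for x
    by (rule has_field_derivative_transform_within_open[OF deriv[OF that], of "{a<..<b}"])
       (use that in \<open>auto simp: G_eq_F\<close>)
  have "continuous_on {a..b} G"
  proof (rule continuous_on_IccI)
    have "\<forall>\<^sub>F x in at_right a. F x = G x" "\<forall>\<^sub>F x in at_left b. F x = G x"
      using eventually_at_right_real[OF \<open>a < b\<close>] eventually_at_left_real[OF \<open>a < b\<close>]
      by (auto simp: G_eq_F elim!: eventually_mono)
    then show "(G \<longlongrightarrow> G a) (at_right a)" "(G \<longlongrightarrow> G b) (at_left b)"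
      using lim_a lim_b \<open>a < b\<close>
      by (auto simp: G_def[of a] G_def[of b] intro: Lim_transform_eventually)
    show "G \<midarrow>x\<rightarrow> G x" if "a < x" "x < b" for x
      using DERIV_isCont[OF deriv_G] that by (simp add: isCont_def)
  qed (rule \<open>a < b\<close>)
  then have "(f has_integral (G b - G a)) {a..b}"
    using \<open>a < b\<close> deriv_G
    by (intro fundamental_theorem_of_calculus_interior)
       (auto simp flip: has_real_derivative_iff_has_vector_derivative)
  then show ?thesis
    using \<open>a < b\<close> by (simp add: has_integral_Icc_iff_Ioo G_def)
qed

definition divpow :: "real \<Rightarrow> nat \<Rightarrow> real" where
  "divpow x n = x ^ n / fact n"

lemma divpow_0_right [simp]: "divpow x 0 = 1"
  by (simp add: divpow_def)

lemma divpow_0_left: "divpow 0 n = (if n = 0 then 1 else 0)"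
  by (simp add: divpow_def)

lemma divpow_nonneg: "0 \<le> x \<Longrightarrow> 0 \<le> divpow x n"
  by (simp add: divpow_def)

lemma divpow_mult: "divpow x m * divpow x n = real (m + n choose m) * divpow x (m + n)"
  by (simp add: divpow_def binomial_fact power_add)

lemma DERIV_divpow:
  assumes "(f has_real_derivative f') (at x)"
  shows "((\<lambda>x. divpow (f x) (Suc n)) has_real_derivative f' * divpow (f x) n) (at x)"
  using DERIV_cdivide[OF DERIV_power[OF assms, of "Suc n"], of "fact (Suc n)"]
  by (simp add: divpow_def del: of_nat_Suc power_Suc)

lemma sum_delta_mult_divpow:
  "(\<Sum>i\<le>q. (if i = 0 then a else 0) * divpow x (q - i)) = a * divpow x q"
  by (subst sum.mono_neutral_right[of _ "{0}"]) auto

lemma tendsto_divpow [tendsto_intros]: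
  "(f \<longlongrightarrow> l) F \<Longrightarrow> ((\<lambda>x. divpow (f x) n) \<longlongrightarrow> divpow l n) F"
  unfolding divpow_def by (intro tendsto_intros) auto

text \<open>The coefficient of \<open>t ^ q\<close> in \<open>exp (t l) * (\<Sum>i. F i * t ^ i)\<close>: if \<open>l' = - u\<close>, then
  multiplication by the exponential turns \<open>\<Phi>' = t u \<Phi> + G\<close> into \<open>(exp (t l) \<Phi>)' = exp (t l) G\<close>.\<close>

definition exp_conv :: "(real \<Rightarrow> real) \<Rightarrow> (nat \<Rightarrow> real \<Rightarrow> real) \<Rightarrow> nat \<Rightarrow> real \<Rightarrow> real" where
  "exp_conv l F q s = (\<Sum>i\<le>q. F i s * divpow (l s) (q - i))"

lemma exp_conv_0: "exp_conv l F 0 = F 0"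
  by (simp add: exp_conv_def fun_eq_iff)

lemma exp_conv_Suc:
  "exp_conv l F (Suc q) = (\<lambda>s. F 0 s * divpow (l s) (Suc q) + exp_conv l (\<lambda>i. F (Suc i)) q s)"
  by (simp add: exp_conv_def fun_eq_iff sum.atMost_Suc_shift del: sum.atMost_Suc)

lemma DERIV_exp_conv:
  assumes l_deriv: "(l has_real_derivative - u) (at s)"
    and F_0: "(F 0 has_real_derivative G 0) (at s)"
    and F_Suc: "\<And>i. (F (Suc i) has_real_derivative u * F i s + G (Suc i)) (at s)"
  shows "(exp_conv l F q has_real_derivative (\<Sum>i\<le>q. G i * divpow (l s) (q - i))) (at s)"
  using F_0 F_Suc
proof (induction q arbitrary: F G)
  case 0
  then show ?case by (simp add: exp_conv_0)
next
  case (Suc q)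
  define H where "H i = (if i = 0 then u * F 0 s else 0) + G (Suc i)" for i
  have "(exp_conv l (\<lambda>i. F (Suc i)) q has_real_derivative
      (\<Sum>i\<le>q. H i * divpow (l s) (q - i))) (at s)"
    using Suc.prems by (intro Suc.IH) (auto simp: H_def)
  also have "(\<Sum>i\<le>q. H i * divpow (l s) (q - i)) =
      u * F 0 s * divpow (l s) q + (\<Sum>i\<le>q. G (Suc i) * divpow (l s) (q - i))"
    by (simp add: H_def distrib_right sum.distrib sum_delta_mult_divpow)
  finally show ?case
    using DERIV_add[OF DERIV_mult'[OF Suc.prems(1) DERIV_divpow[OF l_deriv, of q]]]
    unfolding exp_conv_Suc by (fastforce simp: sum.atMost_Suc_shift simp del: sum.atMost_Suc)
qed

lemma tendsto_exp_conv_of_tendsto_0: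
  assumes "\<And>i. ((\<lambda>s. F i s) \<longlongrightarrow> c i) net" "(l \<longlongrightarrow> 0) net"
  shows "(exp_conv l F q \<longlongrightarrow> c q) net"
proof -
  have "((\<lambda>s. exp_conv l F q s) \<longlongrightarrow> (\<Sum>i\<le>q. c i * divpow 0 (q - i))) net"
    unfolding exp_conv_def using assms by (intro tendsto_intros)
  also have "(\<Sum>i\<le>q. c i * divpow 0 (q - i)) = c q"
    by (subst sum.mono_neutral_right[of _ "{q}"]) (auto simp: divpow_0_left)
  finally show ?thesis .
qed

lemma tendsto_exp_conv_0:
  assumes "\<And>i n. ((\<lambda>s. F i s * l s ^ n) \<longlongrightarrow> 0) net"
  shows "(exp_conv l F q \<longlongrightarrow> 0) net"
proof -
  have "((\<lambda>s. \<Sum>i\<le>q. F i s * l s ^ (q - i) / fact (q - i)) \<longlongrightarrow> (\<Sum>i\<le>q. 0 / fact (q - i))) net"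
    by (intro tendsto_intros assms) auto
  then show ?thesis by (simp add: exp_conv_def[abs_def] divpow_def)
qed

lemma has_integral_divpow_mult:
  assumes "a < b"
    and l_deriv: "\<And>s. s \<in> {a<..<b} \<Longrightarrow> (l has_real_derivative - u s) (at s)"
    and F_0: "\<And>s. s \<in> {a<..<b} \<Longrightarrow> (F 0 has_real_derivative g s) (at s)"
    and F_Suc: "\<And>i s. s \<in> {a<..<b} \<Longrightarrow> (F (Suc i) has_real_derivative u s * F i s) (at s)"
    and at_a: "\<And>i n. ((\<lambda>s. F i s * l s ^ n) \<longlongrightarrow> 0) (at_right a)"
    and at_b: "\<And>i. (F i \<longlongrightarrow> c i) (at_left b)" "(l \<longlongrightarrow> 0) (at_left b)"
  shows "((\<lambda>s. divpow (l s) q * g s) has_integral c q) {a<..<b}"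
proof -
  have "(exp_conv l F q has_real_derivative divpow (l s) q * g s) (at s)" if s: "s \<in> {a<..<b}" for s
  proof -
    have "(exp_conv l F q has_real_derivative
        (\<Sum>i\<le>q. (if i = 0 then g s else 0) * divpow (l s) (q - i))) (at s)"
      using F_0[OF s] F_Suc[OF s] by (intro DERIV_exp_conv[OF l_deriv[OF s]]) auto
    then show ?thesis by (simp add: sum_delta_mult_divpow mult.commute[of "g s"])
  qed
  from has_integral_Ioo_of_limits[OF \<open>a < b\<close> this tendsto_exp_conv_0[OF at_a]
      tendsto_exp_conv_of_tendsto_0[OF at_b]]
  show ?thesis by simp
qed

lemma tendsto_mult_ln_power_at_right_0: "((\<lambda>s::real. s * (- ln s) ^ n) \<longlongrightarrow> 0) (at_right 0)"
  by real_asymp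

lemma tendsto_minus_ln_at_left_1: "((\<lambda>s::real. - ln s) \<longlongrightarrow> 0) (at_left 1)"
  by real_asymp

lemma DERIV_minus_ln:
  "0 < s \<Longrightarrow> ((\<lambda>s::real. - ln s) has_real_derivative - (1 / s)) (at s)"
  by (auto intro!: derivative_eq_intros)

section \<open>Power series on the unit interval\<close>

lemma abs_Abel_mean_le:
  fixes d :: "nat \<Rightarrow> real"
  assumes "0 < x" "x < 1" "0 \<le> \<epsilon>" and tail_le: "\<And>k. K \<le> k \<Longrightarrow> \<bar>d k\<bar> \<le> \<epsilon>"
  shows "\<bar>(1 - x) * (\<Sum>k. d k * x ^ k)\<bar> \<le> (1 - x) * (\<Sum>k<K. \<bar>d k\<bar>) + \<epsilon>"
proof -
  let ?M = "\<Sum>k<K. \<bar>d k\<bar>" and ?b = "\<lambda>k. (if k < K then \<bar>d k\<bar> else 0) + \<epsilon> * x ^ k"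
  have term_le: "\<bar>d k * x ^ k\<bar> \<le> ?b k" for k
  proof (cases "k < K")
    case True
    have "\<bar>d k\<bar> * x ^ k \<le> \<bar>d k\<bar> * 1"
      using assms by (intro mult_left_mono power_le_one) auto
    then show ?thesis using True assms by (simp add: abs_mult add_increasing2)
  next
    case False
    then show ?thesis using tail_le[of k] assms by (auto simp: abs_mult intro!: mult_right_mono)
  qed
  have b_sums: "?b sums (?M + \<epsilon> * (1 / (1 - x)))"
    using sums_If_finite[of "\<lambda>k. k < K" "\<lambda>k. \<bar>d k\<bar>"] assms
    by (intro sums_add sums_mult geometric_sums) (auto simp: lessThan_def)
  have summable: "summable (\<lambda>k. \<bar>d k * x ^ k\<bar>)"
    using term_le by (intro summable_comparison_test'[OF sums_summable[OF b_sums], of 0]) simp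
  have "\<bar>\<Sum>k. d k * x ^ k\<bar> \<le> (\<Sum>k. \<bar>d k * x ^ k\<bar>)"
    using summable by (rule summable_rabs)
  also have "\<dots> \<le> ?M + \<epsilon> * (1 / (1 - x))"
    using term_le summable_sums[OF summable] b_sums by (rule sums_le)
  finally have "(1 - x) * \<bar>\<Sum>k. d k * x ^ k\<bar> \<le> (1 - x) * (?M + \<epsilon> * (1 / (1 - x)))"
    using assms by (intro mult_left_mono) auto
  also have "\<dots> = (1 - x) * ?M + \<epsilon>"
    using assms by (simp add: field_simps)
  finally show ?thesis using assms by (simp add: abs_mult)
qed

lemma tendsto_Abel_means_0:
  fixes d :: "nat \<Rightarrow> real"
  assumes "d \<longlonglongrightarrow> 0"
  shows "((\<lambda>x. (1 - x) * (\<Sum>k. d k * x ^ k)) \<longlongrightarrow> 0) (at_left 1)"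
proof (rule tendstoI)
  fix \<epsilon> :: real assume "0 < \<epsilon>"
  with assms obtain K where tail_less: "\<And>k. K \<le> k \<Longrightarrow> \<bar>d k\<bar> < \<epsilon> / 2"
    using LIMSEQ_D[of d 0 "\<epsilon> / 2"] by auto
  have "((\<lambda>x. (1 - x) * (\<Sum>k<K. \<bar>d k\<bar>)) \<longlongrightarrow> (1 - 1) * (\<Sum>k<K. \<bar>d k\<bar>)) (at_left 1)"
    by (intro tendsto_intros)
  then have "\<forall>\<^sub>F x in at_left 1. (1 - x) * (\<Sum>k<K. \<bar>d k\<bar>) < \<epsilon> / 2"
    using \<open>0 < \<epsilon>\<close> by (intro order_tendstoD) auto
  moreover have "\<forall>\<^sub>F x in at_left 1. x \<in> {0<..<1::real}"
    by (rule eventually_at_left_real) simp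
  ultimately show "\<forall>\<^sub>F x in at_left 1. dist ((1 - x) * (\<Sum>k. d k * x ^ k)) 0 < \<epsilon>"
  proof eventually_elim
    case (elim x)
    then have "\<bar>(1 - x) * (\<Sum>k. d k * x ^ k)\<bar> \<le> (1 - x) * (\<Sum>k<K. \<bar>d k\<bar>) + \<epsilon> / 2"
      using \<open>0 < \<epsilon>\<close> tail_less by (intro abs_Abel_mean_le) (auto intro: less_imp_le)
    with elim show ?case by simp
  qed
qed

lemma fps_conv_radius_ge_1I:
  fixes A :: "'a :: {banach, real_normed_div_algebra} fps"
  assumes "\<And>k. norm (A $ k) \<le> C"
  shows "1 \<le> fps_conv_radius A"
  unfolding fps_conv_radius_def
proof (rule conv_radius_geI_ex')
  fix r :: real assume "0 < r" "ereal r < 1"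
  then have "summable (\<lambda>k. C * r ^ k)"
    by (intro summable_mult summable_geometric) auto
  then show "summable (\<lambda>k. A $ k * of_real r ^ k)"
    by (rule summable_comparison_test'[where N = 0])
       (use assms \<open>0 < r\<close> in \<open>auto simp: norm_mult norm_power intro!: mult_right_mono\<close>)
qed

lemma fps_conv_radius_sum_ge:
  fixes A :: "'i \<Rightarrow> 'a :: {banach, real_normed_div_algebra} fps"
  assumes "\<And>i. i \<in> I \<Longrightarrow> R \<le> fps_conv_radius (A i)"
  shows "R \<le> fps_conv_radius (\<Sum>i\<in>I. A i)"
  using assms
proof (induction I rule: infinite_finite_induct)
  case (insert i I)
  then have "R \<le> min (fps_conv_radius (A i)) (fps_conv_radius (\<Sum>i\<in>I. A i))"
    by simp
  also have "\<dots> \<le> fps_conv_radius (\<Sum>i\<in>insert i I. A i)"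
    using insert.hyps fps_conv_radius_add by simp
  finally show ?case .
qed simp_all

lemma fps_conv_radius_one_minus_monom [simp]:
  fixes e :: "'a :: {banach, real_normed_field}"
  shows "fps_conv_radius (1 - fps_const e * fps_X ^ n) = \<infinity>"
  using fps_conv_radius_diff[of 1 "fps_const e * fps_X ^ n"]
    fps_conv_radius_mult[of "fps_const e" "fps_X ^ n"] by simp

lemma eval_fps_one_minus_monom:
  fixes e :: "'a :: {banach, real_normed_field}"
  shows "eval_fps (1 - fps_const e * fps_X ^ n) x = 1 - e * x ^ n"
  using fps_conv_radius_mult[of "fps_const e" "fps_X ^ n"]
  by (simp add: eval_fps_diff eval_fps_mult)

lemma less_fps_conv_radius: "1 \<le> fps_conv_radius A \<Longrightarrow> \<bar>x\<bar> < 1 \<Longrightarrow> ereal (norm x) < fps_conv_radius A"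
  for A :: "real fps" and x :: real
  by (rule less_le_trans[of _ 1]) (auto simp: one_ereal_def)

theorem Abel_limit:
  fixes A :: "real fps"
  assumes "summable (($) A)"
  shows "(eval_fps A \<longlongrightarrow> suminf (($) A)) (at_left 1)"
proof -
  define D where "D = Abs_fps (\<lambda>n. (\<Sum>k\<le>n. A $ k) - suminf (($) A))"
  have D_lim: "($) D \<longlonglongrightarrow> 0"
    unfolding D_def fps_nth_Abs_fps using summable_LIMSEQ'[OF assms] LIM_zero by blast
  then obtain C where "\<And>k. norm (D $ k) \<le> C"
    using convergent_imp_Bseq[of "($) D"] by (auto simp: convergent_def Bseq_def)
  then have "1 \<le> fps_conv_radius D"
    by (rule fps_conv_radius_ge_1I)
  have "1 \<le> fps_conv_radius A"
    using conv_radius_geI[of "($) A" 1] assms by (simp add: fps_conv_radius_def one_ereal_def)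
  have "(1 - fps_X) * D = A - fps_const (suminf (($) A))"
  proof (rule fps_ext)
    show "((1 - fps_X) * D) $ n = (A - fps_const (suminf (($) A))) $ n" for n
      by (cases n) (simp_all add: D_def left_diff_distrib)
  qed
  have "eval_fps A x = (1 - x) * eval_fps D x + suminf (($) A)" if "\<bar>x\<bar> < 1" for x
  proof -
    have "eval_fps ((1 - fps_X) * D) x = (1 - x) * eval_fps D x"
      using less_fps_conv_radius[OF \<open>1 \<le> fps_conv_radius D\<close> that]
        fps_conv_radius_one_minus_monom[of "1::real" 1] eval_fps_one_minus_monom[of "1::real" 1 x]
      by (simp add: eval_fps_mult)
    then show ?thesis
      using less_fps_conv_radius[OF \<open>1 \<le> fps_conv_radius A\<close> that]
      unfolding \<open>(1 - fps_X) * D = _\<close> by (simp add: eval_fps_diff)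
  qed
  moreover have "\<forall>\<^sub>F x in at_left 1. x \<in> {0<..<1::real}"
    by (rule eventually_at_left_real) simp
  ultimately have "\<forall>\<^sub>F x in at_left 1. (1 - x) * eval_fps D x + suminf (($) A) = eval_fps A x"
    by (auto elim: eventually_mono)
  moreover have "((\<lambda>x. (1 - x) * eval_fps D x + suminf (($) A)) \<longlongrightarrow> 0 + suminf (($) A)) (at_left 1)"
    unfolding eval_fps_def by (intro tendsto_intros tendsto_Abel_means_0 D_lim)
  ultimately show ?thesis
    using Lim_transform_eventually by fastforce
qed

lemma tendsto_eval_fps_mult_ln_power_at_right_0:
  fixes A :: "real fps"
  assumes "A $ 0 = 0" "0 < fps_conv_radius A"
  shows "((\<lambda>s. eval_fps A s * (- ln s) ^ n) \<longlongrightarrow> 0) (at_right 0)"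
proof -
  define B where "B = fps_shift 1 A"
  have A_eq: "A = fps_X * B"
    using assms(1) by (intro fps_ext) (simp add: B_def)
  have "0 < fps_conv_radius B" using assms(2) by (simp add: B_def)
  have "continuous (at_right 0) (eval_fps B)"
    by (rule continuous_eval_fps) (use \<open>0 < fps_conv_radius B\<close> in \<open>simp add: zero_ereal_def\<close>)
  then have "(eval_fps B \<longlongrightarrow> eval_fps B 0) (at_right 0)"
    by (simp add: continuous_within)
  from tendsto_mult[OF this tendsto_mult_ln_power_at_right_0[of n]]
  have lim: "((\<lambda>s. eval_fps B s * (s * (- ln s) ^ n)) \<longlongrightarrow> 0) (at_right 0)"
    by simp
  have "\<forall>\<^sub>F s in nhds 0. s \<in> eball 0 (fps_conv_radius B)"
    using \<open>0 < fps_conv_radius B\<close> by (intro eventually_nhds_in_open) (auto simp: zero_ereal_def)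
  then have "\<forall>\<^sub>F s in at_right 0. s \<in> eball 0 (fps_conv_radius B)"
    by (rule filter_leD[OF at_within_le_nhds])
  then have "\<forall>\<^sub>F s in at_right 0. eval_fps B s * (s * (- ln s) ^ n) = eval_fps A s * (- ln s) ^ n"
    by (rule eventually_mono) (unfold A_eq, simp add: eval_fps_mult)
  with lim show ?thesis
    by (rule Lim_transform_eventually)
qed

definition fps_polylog :: "nat \<Rightarrow> real fps \<Rightarrow> real fps" where
  "fps_polylog c A = Abs_fps (\<lambda>k. A $ k / real k ^ c)"

lemma fps_nth_polylog [simp]: "fps_polylog c A $ k = A $ k / real k ^ c"
  by (simp add: fps_polylog_def)

lemma fps_polylog_0 [simp]: "fps_polylog 0 A = A"
  by (simp add: fps_eq_iff)

lemma fps_polylog_polylog: "fps_polylog c (fps_polylog d A) = fps_polylog (c + d) A"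
  by (simp add: fps_eq_iff power_add)

lemma fps_polylog_add: "fps_polylog c (A + B) = fps_polylog c A + fps_polylog c B"
  by (simp add: fps_eq_iff add_divide_distrib)

lemma fps_polylog_sum: "fps_polylog c (\<Sum>i\<in>I. A i) = (\<Sum>i\<in>I. fps_polylog c (A i))"
  by (simp add: fps_eq_iff fps_sum_nth sum_divide_distrib)

lemma abs_nth_polylog_le: "\<bar>fps_polylog c A $ k\<bar> \<le> \<bar>A $ k\<bar>"
proof (cases "k = 0")
  case False
  then have "\<bar>A $ k\<bar> / real k ^ c \<le> \<bar>A $ k\<bar> / 1"
    by (intro divide_left_mono) auto
  then show ?thesis by (simp add: abs_divide)
qed (cases c; simp)

lemma fps_conv_radius_polylog_ge: "fps_conv_radius A \<le> fps_conv_radius (fps_polylog c A)"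
  unfolding fps_conv_radius_def
proof (rule conv_radius_geI_ex')
  fix r :: real assume r_bounds: "0 < r" "ereal r < conv_radius (($) A)"
  then have "summable (\<lambda>k. norm (A $ k * r ^ k))"
    by (intro abs_summable_in_conv_radius) auto
  then show "summable (\<lambda>k. fps_polylog c A $ k * of_real r ^ k)"
    by (rule summable_comparison_test'[where N = 0])
       (use r_bounds abs_nth_polylog_le in
         \<open>simp add: abs_mult mult_right_mono del: fps_nth_polylog\<close>)
qed

lemma DERIV_eval_fps_polylog:
  assumes "A $ 0 = 0" "s \<noteq> 0" "ereal (norm s) < fps_conv_radius A"
  shows "(eval_fps (fps_polylog (Suc c) A) has_real_derivative
           1 / s * eval_fps (fps_polylog c A) s) (at s)"
proof -
  have radius: "ereal (norm s) < fps_conv_radius (fps_polylog (Suc c) A)"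
    using assms(3) fps_conv_radius_polylog_ge by (rule less_le_trans)
  have "fps_polylog c A = fps_X * fps_deriv (fps_polylog (Suc c) A)"
  proof (rule fps_ext)
    show "fps_polylog c A $ k = (fps_X * fps_deriv (fps_polylog (Suc c) A)) $ k" for k
      using assms(1) by (cases k) (simp_all del: of_nat_Suc)
  qed
  then have "eval_fps (fps_polylog c A) s = s * eval_fps (fps_deriv (fps_polylog (Suc c) A)) s"
    using radius fps_conv_radius_deriv[of "fps_polylog (Suc c) A"]
    by (simp add: eval_fps_mult less_le_trans)
  then show ?thesis
    using has_field_derivative_eval_fps[OF radius] \<open>s \<noteq> 0\<close> by simp
qed

section \<open>Nested sums with alternating parities\<close>

definition two_step_sum :: "real \<Rightarrow> real fps \<Rightarrow> real fps" where
  "two_step_sum e A = A * inverse (1 - fps_const e * fps_X ^ 2)"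

lemma two_step_sum_rec: "two_step_sum e A = A + fps_const e * (fps_X ^ 2 * two_step_sum e A)"
proof -
  have "inverse (1 - fps_const e * fps_X ^ 2) * (1 - fps_const e * fps_X ^ 2) = 1"
    by (intro inverse_mult_eq_1) simp
  then have "two_step_sum e A * (1 - fps_const e * fps_X ^ 2) = A"
    by (simp add: two_step_sum_def mult.assoc)
  then show ?thesis by (simp add: algebra_simps)
qed

lemma two_step_sum_nth [simp]:
  shows two_step_sum_nth_0: "two_step_sum e A $ 0 = A $ 0"
    and two_step_sum_nth_1: "two_step_sum e A $ Suc 0 = A $ Suc 0"
    and two_step_sum_nth_Suc_Suc:
      "two_step_sum e A $ Suc (Suc k) = e * two_step_sum e A $ k + A $ Suc (Suc k)"
  by (subst two_step_sum_rec, simp add: fps_X_power_mult_nth)+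

lemma two_step_sum_sum: "two_step_sum e (\<Sum>i\<in>I. A i) = (\<Sum>i\<in>I. two_step_sum e (A i))"
  by (simp add: two_step_sum_def sum_distrib_right)

lemma two_step_sum_nth_parity:
  assumes "\<And>k. odd (k + r) \<Longrightarrow> A $ k = 0"
  shows "odd (k + r) \<Longrightarrow> two_step_sum e A $ k = 0"
  by (induction k rule: induct_nat_012) (use assms in auto)

lemma two_step_sum_nth_eq_0: "(\<And>j. j \<le> k \<Longrightarrow> A $ j = 0) \<Longrightarrow> two_step_sum e A $ k = 0"
  by (induction k rule: induct_nat_012) auto

lemma two_step_sum_nth_nonneg: "(\<And>k. 0 \<le> A $ k) \<Longrightarrow> 0 \<le> two_step_sum 1 A $ k"
  by (induction k rule: induct_nat_012) auto

lemma abs_two_step_sum_nth_le: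
  assumes "\<bar>e\<bar> \<le> 1" "\<And>k. \<bar>A $ k\<bar> \<le> B $ k"
  shows "\<bar>two_step_sum e A $ k\<bar> \<le> two_step_sum 1 B $ k"
proof (induction k rule: induct_nat_012)
  case (ge2 k)
  have "\<bar>e * two_step_sum e A $ k\<bar> \<le> 1 * two_step_sum 1 B $ k"
    unfolding abs_mult using ge2 assms by (intro mult_mono) auto
  then show ?case using assms(2)[of "Suc (Suc k)"] by simp
qed (use assms in auto)

text \<open>For \<open>k\<close> and \<open>r\<close> of the same parity the sign is \<open>(-1) ^ ((k - r) / 2)\<close>, written without
  subtraction.\<close>

lemma two_step_sum_nth_sign:
  assumes "\<And>k. A $ k = (-1) ^ ((k + r) div 2 + r) * B $ k"
  shows "two_step_sum (-1) A $ k = (-1) ^ ((k + r) div 2 + r) * two_step_sum 1 B $ k"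
  by (induction k rule: induct_nat_012) (simp_all add: assms algebra_simps)

lemma two_step_sum_nth_mult_power_le:
  assumes "\<And>k. 0 \<le> B $ k" "0 \<le> x" "x \<le> 1"
  shows "two_step_sum 1 B $ k * x ^ k \<le> (\<Sum>j\<le>k. B $ j * x ^ j)"
proof (induction k rule: induct_nat_012)
  case 1
  show ?case using assms by simp
next
  case (ge2 k)
  have "two_step_sum 1 B $ k * x ^ Suc (Suc k) \<le> two_step_sum 1 B $ k * x ^ k"
    using two_step_sum_nth_nonneg[of B k] assms by (intro mult_left_mono power_decreasing) auto
  also have "\<dots> \<le> (\<Sum>j\<le>Suc k. B $ j * x ^ j)"
    using ge2(1) assms by (simp add: add_increasing2)
  finally show ?case by (simp add: distrib_right)
qed simp

lemma sum_two_step_sum_nth: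
  "(1 - e * x\<^sup>2) * (\<Sum>k<Suc (Suc n). two_step_sum e A $ k * x ^ k) =
     (\<Sum>k<Suc (Suc n). A $ k * x ^ k)
       - e * x\<^sup>2 * (two_step_sum e A $ n * x ^ n + two_step_sum e A $ Suc n * x ^ Suc n)"
proof -
  let ?c = "\<lambda>k. two_step_sum e A $ k * x ^ k"
  have "(\<Sum>k<Suc (Suc n). ?c k) = (\<Sum>k<Suc (Suc n). A $ k * x ^ k) + e * x\<^sup>2 * (\<Sum>k<n. ?c k)"
    unfolding sum.lessThan_Suc_shift
    by (simp add: sum.distrib sum_distrib_left power2_eq_square algebra_simps)
  moreover have "(\<Sum>k<Suc (Suc n). ?c k) = (\<Sum>k<n. ?c k) + (?c n + ?c (Suc n))"
    by simp
  moreover have "(1 - w) * t = a - w * d" if "t = a + w * s" "t = s + d" for w s t a d :: real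
    using that by algebra
  ultimately show ?thesis by blast
qed

lemma fps_conv_radius_two_step_sum:
  assumes "1 \<le> fps_conv_radius A" "\<bar>e\<bar> \<le> 1"
  shows "1 \<le> fps_conv_radius (two_step_sum e A)"
proof -
  have "norm (two_step_sum e 1 $ k) \<le> 1" for k
    by (induction k rule: induct_nat_012) (use assms(2) in \<open>auto simp: abs_mult mult_le_one\<close>)
  then have "1 \<le> fps_conv_radius (two_step_sum e 1)"
    by (rule fps_conv_radius_ge_1I)
  then have "1 \<le> min (fps_conv_radius A) (fps_conv_radius (two_step_sum e 1))"
    using assms(1) by simp
  also have "\<dots> \<le> fps_conv_radius (A * two_step_sum e 1)"
    by (rule fps_conv_radius_mult)
  also have "A * two_step_sum e 1 = two_step_sum e A"
    by (simp add: two_step_sum_def)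
  finally show ?thesis .
qed

lemma one_minus_mult_square_pos:
  fixes e x :: real
  assumes "\<bar>e\<bar> \<le> 1" "\<bar>x\<bar> < 1"
  shows "0 < 1 - e * x\<^sup>2"
proof -
  have "e * x\<^sup>2 \<le> 1 * x\<^sup>2"
    using assms(1) by (intro mult_right_mono) auto
  also have "\<dots> < 1"
    using assms(2) by (simp add: abs_square_less_1)
  finally show ?thesis by simp
qed

lemma eval_fps_two_step_sum:
  assumes "1 \<le> fps_conv_radius A" "\<bar>e\<bar> \<le> 1" "\<bar>x\<bar> < 1"
  shows "eval_fps (two_step_sum e A) x = eval_fps A x / (1 - e * x\<^sup>2)"
proof -
  have "A = two_step_sum e A * (1 - fps_const e * fps_X ^ 2)"
    using two_step_sum_rec[of e A] by (simp add: algebra_simps)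
  then have "eval_fps A x = eval_fps (two_step_sum e A * (1 - fps_const e * fps_X ^ 2)) x"
    by simp
  also have "\<dots> = eval_fps (two_step_sum e A) x * (1 - e * x\<^sup>2)"
    using less_fps_conv_radius[OF fps_conv_radius_two_step_sum[OF assms(1,2)] assms(3)]
    by (simp add: eval_fps_mult eval_fps_one_minus_monom)
  finally show ?thesis
    using one_minus_mult_square_pos[OF assms(2,3)] by simp
qed

definition nested_sum_step :: "real \<Rightarrow> real fps \<Rightarrow> real fps" where
  "nested_sum_step e A = fps_const 2 * (fps_X * two_step_sum e A)"

lemma nested_sum_step_nth [simp]:
  shows nested_sum_step_nth_0: "nested_sum_step e A $ 0 = 0"
    and nested_sum_step_nth_Suc: "nested_sum_step e A $ Suc k = 2 * two_step_sum e A $ k"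
  by (simp_all add: nested_sum_step_def)

lemma nested_sum_step_sum:
  "nested_sum_step e (\<Sum>i\<in>I. A i) = (\<Sum>i\<in>I. nested_sum_step e (A i))"
  by (simp add: nested_sum_step_def two_step_sum_sum sum_distrib_left)

lemma fps_conv_radius_nested_sum_step:
  assumes "1 \<le> fps_conv_radius A" "\<bar>e\<bar> \<le> 1"
  shows "1 \<le> fps_conv_radius (nested_sum_step e A)"
  using fps_conv_radius_two_step_sum[OF assms] fps_conv_radius_mult[of fps_X "two_step_sum e A"]
  by (simp add: nested_sum_step_def fps_conv_radius_cmult_left)

lemma eval_fps_nested_sum_step:
  assumes "1 \<le> fps_conv_radius A" "\<bar>e\<bar> \<le> 1" "\<bar>x\<bar> < 1"
  shows "eval_fps (nested_sum_step e A) x = 2 * x * (eval_fps A x / (1 - e * x\<^sup>2))"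
proof -
  have radius: "ereal (norm x) < fps_conv_radius (two_step_sum e A)"
    using fps_conv_radius_two_step_sum[OF assms(1,2)] assms(3) by (rule less_fps_conv_radius)
  then have "ereal (norm x) < fps_conv_radius (fps_X * two_step_sum e A)"
    using fps_conv_radius_mult[of fps_X "two_step_sum e A"] by (simp add: less_le_trans)
  with radius show ?thesis
    using eval_fps_two_step_sum[OF assms] by (simp add: nested_sum_step_def eval_fps_mult)
qed

text \<open>With \<open>N\<^sub>j = 2 n\<^sub>j - j\<close>, the chains defining \<open>Tbar [c\<^sub>1, \<dots>, c\<^sub>r]\<close> become
  \<open>0 < N\<^sub>1 < \<dots> < N\<^sub>r\<close> with \<open>N\<^sub>j\<close> of the parity of \<open>j\<close>, and \<open>nested_sum 1 [c\<^sub>r, \<dots>, c\<^sub>1] $ k\<close> is the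
  sum of \<open>\<Prod>j. 2 / N\<^sub>j ^ c\<^sub>j\<close> over those with \<open>N\<^sub>r = k\<close> (note the reversed list). The choice \<open>e = -1\<close>
  inserts the sign \<open>(-1) ^ ((k - r) / 2)\<close>.\<close>

primrec nested_sum :: "real \<Rightarrow> nat list \<Rightarrow> real fps" where
  "nested_sum e [] = 1"
| "nested_sum e (c # cs) = fps_polylog c (nested_sum_step e (nested_sum e cs))"

lemma nested_sum_Cons_nth_Suc:
  "nested_sum e (c # cs) $ Suc k = 2 * two_step_sum e (nested_sum e cs) $ k / real (Suc k) ^ c"
  by simp

lemma nested_sum_Suc_Cons: "nested_sum e (Suc c # cs) = fps_polylog 1 (nested_sum e (c # cs))"
  by (simp add: fps_polylog_polylog)

lemma abs_nested_sum_nth_le: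
  assumes "\<bar>e\<bar> \<le> 1"
  shows "\<bar>nested_sum e cs $ k\<bar> \<le> nested_sum 1 cs $ k"
proof (induction cs arbitrary: k)
  case (Cons c cs)
  show ?case
  proof (cases k)
    case (Suc j)
    have "\<bar>two_step_sum e (nested_sum e cs) $ j\<bar> \<le> two_step_sum 1 (nested_sum 1 cs) $ j"
      using assms Cons.IH by (rule abs_two_step_sum_nth_le)
    then show ?thesis
      unfolding Suc nested_sum_Cons_nth_Suc abs_divide abs_mult
      by (auto intro!: divide_right_mono simp: power_abs)
  qed simp
qed simp

lemma nested_sum_nth_parity: "odd (k + length cs) \<Longrightarrow> nested_sum e cs $ k = 0"
proof (induction cs arbitrary: k)
  case (Cons c cs)
  then show ?case
    by (cases k) (auto intro!: two_step_sum_nth_parity[where r = "length cs"])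
qed (auto elim: oddE)

lemma nested_sum_nth_eq_0: "k < length cs \<Longrightarrow> nested_sum e cs $ k = 0"
proof (induction cs arbitrary: k)
  case (Cons c cs)
  then show ?case
    by (cases k) (auto intro!: two_step_sum_nth_eq_0)
qed simp

lemma nested_sum_nth_sign:
  "nested_sum (-1) cs $ k = (-1) ^ ((k + length cs) div 2 + length cs) * nested_sum 1 cs $ k"
proof (induction cs arbitrary: k)
  case (Cons c cs)
  show ?case
  proof (cases k)
    case (Suc j)
    then show ?thesis
      using two_step_sum_nth_sign[OF Cons.IH, of j] by (simp del: of_nat_Suc)
  qed simp
qed simp

lemma fps_conv_radius_nested_sum: "\<bar>e\<bar> \<le> 1 \<Longrightarrow> 1 \<le> fps_conv_radius (nested_sum e cs)"
proof (induction cs)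
  case (Cons c cs)
  then show ?case
    unfolding nested_sum.simps
    by (intro order_trans[OF _ fps_conv_radius_polylog_ge] fps_conv_radius_nested_sum_step) auto
qed simp

text \<open>The function \<open>h\<close> is \<open>ln ((1 + x) / (1 - x))\<close> for \<open>e = 1\<close> and \<open>2 * arctan x\<close> for \<open>e = -1\<close>.\<close>

lemma eval_fps_nested_sum_replicate_1:
  assumes e_le: "\<bar>e\<bar> \<le> 1" and "h 0 = 0"
    and h_deriv: "\<And>x. \<bar>x\<bar> < 1 \<Longrightarrow> (h has_real_derivative 2 / (1 - e * x\<^sup>2)) (at x)"
    and x_less: "\<bar>x\<bar> < 1"
  shows "eval_fps (nested_sum e (replicate r 1)) x = divpow (h x) r"
  using x_less
proof (induction r arbitrary: x)
  case 0
  show ?case by simp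
next
  case (Suc r)
  let ?N = "\<lambda>r. nested_sum e (replicate r 1)"
  let ?diff = "\<lambda>x. eval_fps (?N (Suc r)) x - divpow (h x) (Suc r)"
  note radius = fps_conv_radius_nested_sum[OF e_le]
  have deriv: "(?diff has_real_derivative 0) (at y)" if y_less: "\<bar>y\<bar> < 1" for y
  proof -
    have "fps_deriv (?N (Suc r)) = fps_const 2 * two_step_sum e (?N r)"
      by (rule fps_ext) (simp del: of_nat_Suc)
    then have "eval_fps (fps_deriv (?N (Suc r))) y = 2 * eval_fps (two_step_sum e (?N r)) y"
      using less_fps_conv_radius[OF fps_conv_radius_two_step_sum[OF radius e_le] y_less]
      by (simp add: eval_fps_mult)
    also have "\<dots> = 2 / (1 - e * y\<^sup>2) * divpow (h y) r"
      using eval_fps_two_step_sum[OF radius e_le y_less] Suc.IH[OF y_less] by simp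
    finally have "(eval_fps (?N (Suc r)) has_real_derivative
        2 / (1 - e * y\<^sup>2) * divpow (h y) r) (at y)"
      using has_field_derivative_eval_fps[OF less_fps_conv_radius[OF radius y_less]] by metis
    from DERIV_diff[OF this DERIV_divpow[OF h_deriv[OF y_less], of r]] show ?thesis by simp
  qed
  have "\<exists>c. \<forall>y\<in>ball 0 1. ?diff y = c"
    by (rule has_field_derivative_zero_constant[OF convex_ball
          has_field_derivative_at_within[OF deriv]]) simp
  then obtain c where diff_eq: "\<And>y. y \<in> ball 0 1 \<Longrightarrow> ?diff y = c"
    by blast
  have "?diff 0 = 0"
    by (simp add: eval_fps_at_0 \<open>h 0 = 0\<close> divpow_0_left)
  with diff_eq[of 0] diff_eq[of x] Suc.prems show ?case by simp
qed

section \<open>Square-root decay\<close>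

text \<open>The coefficients that occur are of size \<open>(ln k) ^ r / k\<close>; the crude bound \<open>1 / sqrt k\<close> is
  stable under the recursion for \<open>nested_sum\<close> and suffices for all convergence questions.\<close>

definition sqrt_decay :: "real fps \<Rightarrow> bool" where
  "sqrt_decay A \<longleftrightarrow> (\<exists>C. \<forall>k. \<bar>A $ k\<bar> \<le> C / sqrt (real (Suc k)))"

lemma abs_two_step_sum_nth_le_sqrt:
  assumes e_le: "\<bar>e\<bar> \<le> 1" and A_le: "\<And>k. \<bar>A $ k\<bar> \<le> C / sqrt (real (Suc k))"
  shows "\<bar>two_step_sum e A $ k\<bar> \<le> C * sqrt (real (Suc k))"
proof (induction k rule: induct_nat_012)
  case 0
  show ?case using A_le[of 0] by simp
next
  case 1
  have "0 \<le> C" using A_le[of 0] by simp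
  then have "C / sqrt 2 \<le> C * sqrt 2" by (simp add: field_simps)
  then show ?case using A_le[of 1] by simp
next
  case (ge2 k)
  have "0 \<le> C" using A_le[of 0] by simp
  define u v where "u = sqrt (real (Suc k))" and "v = sqrt (real (Suc (Suc (Suc k))))"
  have "0 < v" "u\<^sup>2 + 2 = v\<^sup>2"
    by (simp_all add: u_def v_def)
  then have "u * v + 1 \<le> v * v"
    using sum_squares_bound[of u v] by (simp add: power2_eq_square)
  then have "u + 1 / v \<le> v"
    using \<open>0 < v\<close> by (simp add: field_simps)
  have "\<bar>e * two_step_sum e A $ k\<bar> \<le> 1 * (C * u)"
    unfolding abs_mult using ge2(1) e_le by (intro mult_mono) (auto simp: u_def)
  moreover have "\<bar>A $ Suc (Suc k)\<bar> \<le> C / v"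
    using A_le[of "Suc (Suc k)"] by (simp add: v_def)
  ultimately have "\<bar>two_step_sum e A $ Suc (Suc k)\<bar> \<le> C * (u + 1 / v)"
    by (simp add: algebra_simps)
  also have "\<dots> \<le> C * v"
    using \<open>u + 1 / v \<le> v\<close> \<open>0 \<le> C\<close> by (rule mult_left_mono)
  finally show ?case by (simp add: v_def)
qed

lemma sqrt_decay_polylog_nested_sum_step:
  assumes "sqrt_decay A" "\<bar>e\<bar> \<le> 1" "0 < c"
  shows "sqrt_decay (fps_polylog c (nested_sum_step e A))"
proof -
  obtain C where A_le: "\<And>k. \<bar>A $ k\<bar> \<le> C / sqrt (real (Suc k))"
    using assms(1) by (auto simp: sqrt_decay_def)
  then have "0 \<le> C" using A_le[of 0] by simp
  have "\<bar>fps_polylog c (nested_sum_step e A) $ k\<bar> \<le> 4 * C / sqrt (real (Suc k))" for k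
  proof (cases k)
    case 0
    then show ?thesis using \<open>0 \<le> C\<close> by simp
  next
    case (Suc j)
    define u where "u = sqrt (real k)"
    have u_square: "0 < u" "u * u = real k" by (simp_all add: u_def Suc)
    have "real k ^ 1 \<le> real k ^ c"
      using assms(3) Suc by (intro power_increasing) auto
    then have "\<bar>fps_polylog c (nested_sum_step e A) $ k\<bar>
        \<le> 2 * \<bar>two_step_sum e A $ j\<bar> / real k"
      using Suc by (simp add: abs_mult abs_divide) (intro frac_le, auto)
    also have "\<dots> \<le> 2 * (C * u) / (u * u)"
      using abs_two_step_sum_nth_le_sqrt[OF assms(2) A_le, of j] u_square(1)
      unfolding u_square(2)[symmetric]
      by (intro divide_right_mono mult_left_mono) (auto simp: u_def Suc)
    also have "\<dots> = 4 * C / (2 * u)"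
      using u_square(1) by simp
    also have "\<dots> \<le> 4 * C / sqrt (real (Suc k))"
    proof -
      have "sqrt (real (Suc k)) \<le> sqrt (4 * real k)"
        using Suc by (intro real_sqrt_le_mono) simp
      then show ?thesis
        using \<open>0 \<le> C\<close> u_square(1) by (intro divide_left_mono) (auto simp: u_def real_sqrt_mult)
    qed
    finally show ?thesis .
  qed
  then show ?thesis unfolding sqrt_decay_def by blast
qed

lemma sqrt_decay_nested_sum: "\<bar>e\<bar> \<le> 1 \<Longrightarrow> \<forall>c\<in>set cs. 0 < c \<Longrightarrow> sqrt_decay (nested_sum e cs)"
proof (induction cs)
  case Nil
  have "\<bar>nested_sum e [] $ k\<bar> \<le> 1 / sqrt (real (Suc k))" for k
    by (cases k) auto
  then show ?case unfolding sqrt_decay_def by blast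
next
  case (Cons c cs)
  then show ?case unfolding nested_sum.simps by (intro sqrt_decay_polylog_nested_sum_step) auto
qed

lemma sqrt_decay_imp_bigo:
  assumes "sqrt_decay A"
  shows "($) A \<in> O(\<lambda>k. 1 / sqrt (real (Suc k)))"
proof -
  obtain C where "\<And>k. \<bar>A $ k\<bar> \<le> C / sqrt (real (Suc k))"
    using assms by (auto simp: sqrt_decay_def)
  then show ?thesis
    by (intro bigoI[where c = C]) auto
qed

lemma two_step_sum_nth_bigo_sqrt:
  assumes "sqrt_decay A" "\<bar>e\<bar> \<le> 1"
  shows "($) (two_step_sum e A) \<in> O(\<lambda>k. sqrt (real (Suc k)))"
proof -
  obtain C where "\<And>k. \<bar>A $ k\<bar> \<le> C / sqrt (real (Suc k))"
    using assms(1) by (auto simp: sqrt_decay_def)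
  then show ?thesis
    using abs_two_step_sum_nth_le_sqrt[OF assms(2)] by (intro bigoI[where c = C]) auto
qed

lemma summable_of_bigo_powr:
  fixes f :: "nat \<Rightarrow> real"
  assumes "f \<in> O(\<lambda>k. real k powr a)" "a < - 1"
  shows "summable f"
  using assms(2)
  by (intro summable_comparison_test_bigo[OF _ assms(1)]) (simp add: summable_real_powr_iff)

lemma summable_sqrt_decay_mult:
  assumes "sqrt_decay A" "w \<in> O(\<lambda>k. 1 / real k)"
  shows "summable (\<lambda>k. A $ k * w k)"
proof (rule summable_of_bigo_powr[where a = "- 3/2"])
  have "(\<lambda>k. A $ k * w k) \<in> O(\<lambda>k. 1 / sqrt (real (Suc k)) * (1 / real k))"
    using sqrt_decay_imp_bigo[OF assms(1)] assms(2) by (rule landau_o.big.mult)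
  also have "(\<lambda>k. 1 / sqrt (real (Suc k)) * (1 / real k)) \<in> O(\<lambda>k. real k powr (- 3/2))"
    by real_asymp
  finally show "(\<lambda>k. A $ k * w k) \<in> O(\<lambda>k. real k powr (- 3/2))" .
qed simp

lemma summable_of_summable_add_shift2:
  fixes y :: "nat \<Rightarrow> real"
  assumes "summable (\<lambda>k. y (Suc (Suc k)) + y k)" "y \<longlonglongrightarrow> 0"
  shows "summable y"
proof -
  let ?z = "\<lambda>k. y (Suc (Suc k)) + y k"
  have partial_sum: "sum y {..<n} = (sum ?z {..<n} + y 0 + y 1 - y n - y (Suc n)) / 2" for n
    by (induction n) (simp_all add: field_simps)
  have "(\<lambda>n. (sum ?z {..<n} + y 0 + y 1 - y n - y (Suc n)) / 2)
      \<longlonglongrightarrow> (suminf ?z + y 0 + y 1 - 0 - 0) / 2"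
    by (intro tendsto_intros summable_LIMSEQ assms LIMSEQ_Suc[OF assms(2)]) simp_all
  then show ?thesis
    unfolding partial_sum[symmetric] by (auto simp: summable_def sums_def)
qed

lemma summable_two_step_sum_div:
  assumes "sqrt_decay A"
  shows "summable (\<lambda>k. two_step_sum (-1) A $ k / real (Suc k))" (is "summable ?y")
proof (rule summable_of_summable_add_shift2)
  let ?c = "($) (two_step_sum (-1) A)"
  have two_step_bigo: "?c \<in> O(\<lambda>k. sqrt (real (Suc k)))"
    using assms by (rule two_step_sum_nth_bigo_sqrt) simp
  have "(\<lambda>k. ?c k * (1 / real (Suc k))) \<in> O(\<lambda>k. sqrt (real (Suc k)) * (1 / real (Suc k)))"
    by (rule landau_o.big.mult[OF two_step_bigo]) simp
  then have "?y \<in> O(\<lambda>k. sqrt (real (Suc k)) / real (Suc k))"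
    by simp
  also have "(\<lambda>k. sqrt (real (Suc k)) / real (Suc k)) \<in> o(\<lambda>_. 1)"
    by real_asymp
  finally show "?y \<longlonglongrightarrow> 0"
    using smalloD_tendsto by fastforce
  have "(\<lambda>k. ?c k * (1 / real (Suc k) - 1 / real (Suc (Suc (Suc k)))))
      \<in> O(\<lambda>k. sqrt (real (Suc k)) * (1 / real k ^ 2))"
    by (rule landau_o.big.mult[OF two_step_bigo]) real_asymp
  also have "(\<lambda>k. sqrt (real (Suc k)) * (1 / real k ^ 2)) \<in> O(\<lambda>k. real k powr (- 3/2))"
    by real_asymp
  finally have "summable (\<lambda>k. ?c k * (1 / real (Suc k) - 1 / real (Suc (Suc (Suc k)))))"
    by (rule summable_of_bigo_powr) simp
  moreover have "summable (\<lambda>k. A $ k * (1 / real (Suc k)))"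
    using assms by (rule summable_sqrt_decay_mult) real_asymp
  then have "summable (\<lambda>k. A $ Suc (Suc k) / real (Suc (Suc (Suc k))))"
    using summable_iff_shift[of "\<lambda>k. A $ k * (1 / real (Suc k))" 2] by simp
  ultimately have "summable (\<lambda>k. ?c k * (1 / real (Suc k) - 1 / real (Suc (Suc (Suc k))))
      + A $ Suc (Suc k) / real (Suc (Suc (Suc k))))"
    by (rule summable_add)
  then show "summable (\<lambda>k. ?y (Suc (Suc k)) + ?y k)"
    by (simp add: algebra_simps add_divide_distrib diff_divide_distrib)
qed

lemma summable_nested_sum_alternating:
  assumes "\<forall>c\<in>set cs. 0 < c"
  shows "summable (($) (nested_sum (-1) cs))"
proof (cases cs)
  case Nil
  show ?thesis
    unfolding Nil by (rule summable_finite[of "{0}"]) auto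
next
  case (Cons c ds)
  then have "0 < c" "\<forall>c\<in>set ds. 0 < c" using assms by auto
  have "summable (\<lambda>k. nested_sum (-1) cs $ Suc k)"
  proof (cases "c = 1")
    case True
    have "summable (\<lambda>k. 2 * (two_step_sum (-1) (nested_sum (-1) ds) $ k / real (Suc k)))"
      using \<open>\<forall>c\<in>set ds. 0 < c\<close>
      by (intro summable_mult summable_two_step_sum_div sqrt_decay_nested_sum) auto
    then show ?thesis by (simp add: Cons True)
  next
    case False
    with \<open>0 < c\<close> obtain b where c_eq: "c = Suc b" "0 < b" by (cases c) auto
    have "summable (\<lambda>k. nested_sum (-1) (b # ds) $ k * (1 / real k))"
      using c_eq(2) \<open>\<forall>c\<in>set ds. 0 < c\<close>
      by (intro summable_sqrt_decay_mult sqrt_decay_nested_sum) auto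
    then have "summable (\<lambda>k. nested_sum (-1) cs $ k)"
      unfolding Cons c_eq(1) nested_sum_Suc_Cons fps_nth_polylog by simp
    then show ?thesis by (simp only: summable_Suc_iff)
  qed
  then show ?thesis by (simp only: summable_Suc_iff)
qed

section \<open>The substitution \<open>x = (1 - s) / (1 + s)\<close>\<close>

definition cayley :: "real \<Rightarrow> real" where
  "cayley s = (1 - s) / (1 + s)"

lemma cayley_bounds: "0 < s \<Longrightarrow> s < 1 \<Longrightarrow> 0 < cayley s \<and> cayley s < 1"
  by (simp add: cayley_def)

lemma DERIV_cayley: "0 < s \<Longrightarrow> (cayley has_real_derivative - (2 / (1 + s)\<^sup>2)) (at s)"
  unfolding cayley_def by (auto intro!: derivative_eq_intros simp: power2_eq_square field_simps)

lemma one_minus_cayley_square: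
  assumes "0 < s"
  shows "1 - (cayley s)\<^sup>2 = 2 * s * (2 / (1 + s)\<^sup>2)"
proof -
  have "1 - (cayley s)\<^sup>2 = ((1 + s)\<^sup>2 - (1 - s)\<^sup>2) / (1 + s)\<^sup>2"
    using assms by (simp add: cayley_def power_divide diff_divide_distrib[of "(1 + s)\<^sup>2"])
  also have "(1 + s)\<^sup>2 - (1 - s)\<^sup>2 = 4 * s"
    by (simp add: power2_eq_square algebra_simps)
  finally show ?thesis by simp
qed

lemma one_plus_cayley_square:
  assumes "0 < s"
  shows "2 / (1 + s)\<^sup>2 / (1 + (cayley s)\<^sup>2) = 1 / (1 + s\<^sup>2)"
proof -
  have "(1 + s)\<^sup>2 * (1 + (cayley s)\<^sup>2) = (1 + s)\<^sup>2 + (1 - s)\<^sup>2"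
    using assms by (simp add: cayley_def power_divide distrib_left)
  also have "\<dots> = 2 * (1 + s\<^sup>2)"
    by (simp add: power2_eq_square algebra_simps)
  finally have denominator: "(1 + s)\<^sup>2 * (1 + (cayley s)\<^sup>2) = 2 * (1 + s\<^sup>2)" .
  show ?thesis
    unfolding divide_divide_eq_left denominator
    by (subst mult_divide_mult_cancel_left[of 2 1, symmetric]) auto
qed

lemma tendsto_cayley:
  shows tendsto_cayley_at_right_0: "(cayley \<longlongrightarrow> 1) (at_right 0)"
    and tendsto_cayley_at_left_1: "(cayley \<longlongrightarrow> 0) (at_left 1)"
proof -
  have "(cayley \<longlongrightarrow> (1 - 0) / (1 + 0)) (at_right 0)" "(cayley \<longlongrightarrow> (1 - 1) / (1 + 1)) (at_left 1)"
    unfolding cayley_def by (intro tendsto_intros; simp)+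
  then show "(cayley \<longlongrightarrow> 1) (at_right 0)" "(cayley \<longlongrightarrow> 0) (at_left 1)" by simp_all
qed

lemma ln_one_minus_cayley:
  assumes "0 < s" "s < 1"
  shows "ln (1 - cayley s) = ln s + ln (1 + cayley s)"
proof -
  have "1 - cayley s = s * (1 + cayley s)"
    using assms by (simp add: cayley_def field_simps)
  then show ?thesis
    using cayley_bounds[OF assms] assms by (simp add: ln_mult)
qed

definition cayley_angle :: "real \<Rightarrow> real" where
  "cayley_angle s = pi / 2 - 2 * arctan s"

lemma arctan_cayley:
  assumes "0 < s" "s < 1"
  shows "2 * arctan (cayley s) = cayley_angle s"
proof -
  have "arctan 1 + arctan (- s) = arctan ((1 + - s) / (1 - 1 * - s))"
    using assms by (intro arctan_add) auto
  then show ?thesis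
    by (simp add: arctan_one arctan_minus cayley_def cayley_angle_def)
qed

lemma DERIV_cayley_angle: "(cayley_angle has_real_derivative - (2 / (1 + s\<^sup>2))) (at s)"
proof -
  have "(cayley_angle has_real_derivative 0 - 2 * inverse (1 + s\<^sup>2)) (at s)"
    unfolding cayley_angle_def by (intro DERIV_diff DERIV_const DERIV_cmult DERIV_arctan)
  then show ?thesis by (simp only: divide_inverse diff_0)
qed

lemma tendsto_cayley_angle: "(cayley_angle \<longlongrightarrow> cayley_angle l) (at l within S)"
  unfolding cayley_angle_def by (intro tendsto_intros)

lemma cayley_angle_1 [simp]: "cayley_angle 1 = 0"
  by (simp add: cayley_angle_def arctan_one)

section \<open>Sums over compositions as an integral\<close>

lemma Icomp_iff: "cs \<in> Icomp n r \<longleftrightarrow> length cs = r \<and> (\<forall>c\<in>set cs. 0 < c) \<and> sum_list cs = n"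
  by (auto simp: Icomp_def all_set_conv_all_nth)

lemma finite_Icomp: "finite (Icomp n r)"
proof (rule finite_subset)
  show "Icomp n r \<subseteq> {cs. set cs \<subseteq> {..n} \<and> length cs = r}"
    by (auto simp: Icomp_iff member_le_sum_list)
qed (rule finite_lists_length_eq, simp)

lemma Icomp_0_right: "Icomp n 0 = (if n = 0 then {[]} else {})"
  by (auto simp: Icomp_iff)

lemma Icomp_eq_empty: "n < r \<Longrightarrow> Icomp n r = {}"
proof -
  have "length cs \<le> sum_list cs" if "\<forall>c\<in>set cs. 0 < c" for cs :: "nat list"
    using that by (induction cs) auto
  then show "n < r \<Longrightarrow> Icomp n r = {}" by (fastforce simp: Icomp_iff)
qed

lemma Icomp_SucE:
  assumes "cs \<in> Icomp n (Suc r)"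
  obtains c ds where "cs = Suc c # ds"
  using assms by (cases cs; cases "hd cs") (auto simp: Icomp_iff)

lemma Icomp_Suc_Suc:
  "Icomp (Suc n) (Suc r) = (#) 1 ` Icomp n r \<union> (\<lambda>cs. Suc (hd cs) # tl cs) ` Icomp n (Suc r)"
proof (intro equalityI subsetI)
  fix cs assume cs_in: "cs \<in> Icomp (Suc n) (Suc r)"
  then obtain c ds where cs_eq: "cs = Suc c # ds" by (rule Icomp_SucE)
  show "cs \<in> (#) 1 ` Icomp n r \<union> (\<lambda>cs. Suc (hd cs) # tl cs) ` Icomp n (Suc r)"
  proof (cases "c = 0")
    case False
    with cs_in cs_eq have "c # ds \<in> Icomp n (Suc r)" by (auto simp: Icomp_iff)
    then show ?thesis
      by (intro UnI2 image_eqI[of _ _ "c # ds"]) (simp_all add: cs_eq)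
  qed (use cs_in cs_eq in \<open>auto simp: Icomp_iff\<close>)
next
  fix cs assume "cs \<in> (#) 1 ` Icomp n r \<union> (\<lambda>cs. Suc (hd cs) # tl cs) ` Icomp n (Suc r)"
  then show "cs \<in> Icomp (Suc n) (Suc r)"
  proof (elim UnE imageE)
    fix ds assume "cs = Suc (hd ds) # tl ds" and ds_in: "ds \<in> Icomp n (Suc r)"
    with ds_in show ?thesis by (cases ds) (auto simp: Icomp_iff)
  qed (simp add: Icomp_iff)
qed

definition composition_sum :: "real \<Rightarrow> nat \<Rightarrow> nat \<Rightarrow> real fps" where
  "composition_sum e r n = (\<Sum>cs\<in>Icomp n r. nested_sum e cs)"

lemma composition_sum_nth: "($) (composition_sum e r n) = (\<lambda>k. \<Sum>cs\<in>Icomp n r. nested_sum e cs $ k)"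
  by (simp add: fun_eq_iff composition_sum_def fps_sum_nth)

lemma composition_sum_0: "composition_sum e 0 n = (if n = 0 then 1 else 0)"
  by (simp add: composition_sum_def Icomp_0_right)

lemma composition_sum_eq_0: "n < r \<Longrightarrow> composition_sum e r n = 0"
  by (simp add: composition_sum_def Icomp_eq_empty)

lemma composition_sum_Suc_nth_0: "composition_sum e (Suc r) n $ 0 = 0"
  by (auto simp: composition_sum_nth intro!: sum.neutral elim!: Icomp_SucE)

lemma composition_sum_Suc_Suc:
  "composition_sum e (Suc r) (Suc n) =
     fps_polylog 1 (composition_sum e (Suc r) n + nested_sum_step e (composition_sum e r n))"
proof -
  let ?incr = "\<lambda>cs::nat list. Suc (hd cs) # tl cs"
  have inj: "inj_on ?incr (Icomp n (Suc r))"
    by (auto simp: inj_on_def elim!: Icomp_SucE)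
  have disjoint: "(#) 1 ` Icomp n r \<inter> ?incr ` Icomp n (Suc r) = {}"
    by (auto elim!: Icomp_SucE)
  have "composition_sum e (Suc r) (Suc n) =
      (\<Sum>cs\<in>Icomp n r. nested_sum e (1 # cs)) + (\<Sum>cs\<in>Icomp n (Suc r). nested_sum e (?incr cs))"
    unfolding composition_sum_def Icomp_Suc_Suc
    by (subst sum.union_disjoint)
       (use disjoint inj in \<open>auto simp: finite_Icomp sum.reindex o_def simp del: nested_sum.simps\<close>)
  also have "(\<Sum>cs\<in>Icomp n (Suc r). nested_sum e (?incr cs)) =
      fps_polylog 1 (composition_sum e (Suc r) n)"
    unfolding composition_sum_def fps_polylog_sum
  proof (rule sum.cong)
    fix cs assume "cs \<in> Icomp n (Suc r)"
    then show "nested_sum e (?incr cs) = fps_polylog 1 (nested_sum e cs)"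
      using nested_sum_Suc_Cons by (auto elim!: Icomp_SucE simp del: nested_sum.simps)
  qed simp
  also have "(\<Sum>cs\<in>Icomp n r. nested_sum e (1 # cs)) =
      fps_polylog 1 (nested_sum_step e (composition_sum e r n))"
    by (simp add: composition_sum_def fps_polylog_sum nested_sum_step_sum)
  finally show ?thesis by (simp add: fps_polylog_add add.commute)
qed

lemma fps_conv_radius_composition_sum:
  "\<bar>e\<bar> \<le> 1 \<Longrightarrow> 1 \<le> fps_conv_radius (composition_sum e r n)"
  unfolding composition_sum_def by (intro fps_conv_radius_sum_ge fps_conv_radius_nested_sum)

lemma summable_composition_sum_alternating: "summable (($) (composition_sum (-1) r n))"
  unfolding composition_sum_nth
  by (intro summable_sum summable_nested_sum_alternating) (simp add: Icomp_iff)

lemma DERIV_eval_fps_composition_sum: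
  assumes e_le: "\<bar>e\<bar> \<le> 1" and s_bounds: "0 < s" "s < 1"
  shows "(eval_fps (composition_sum e (Suc r) (Suc n)) has_real_derivative
           1 / s * eval_fps (composition_sum e (Suc r) n) s
           + 2 / (1 - e * s\<^sup>2) * eval_fps (composition_sum e r n) s) (at s)"
proof -
  let ?A = "composition_sum e (Suc r) n" and ?B = "nested_sum_step e (composition_sum e r n)"
  have "\<bar>s\<bar> < 1" using s_bounds by simp
  note radius_ge_1 = fps_conv_radius_composition_sum[OF e_le]
  have radius: "ereal (norm s) < fps_conv_radius ?A" "ereal (norm s) < fps_conv_radius ?B"
    using less_fps_conv_radius[OF _ \<open>\<bar>s\<bar> < 1\<close>] radius_ge_1
      fps_conv_radius_nested_sum_step[OF radius_ge_1 e_le] by auto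
  then have "ereal (norm s) < fps_conv_radius (?A + ?B)"
    by (intro less_le_trans[OF _ fps_conv_radius_add]) simp
  then have "(eval_fps (fps_polylog (Suc 0) (?A + ?B)) has_real_derivative
      1 / s * eval_fps (fps_polylog 0 (?A + ?B)) s) (at s)"
    using s_bounds by (intro DERIV_eval_fps_polylog) (auto simp: composition_sum_Suc_nth_0)
  moreover have "eval_fps (?A + ?B) s =
      eval_fps ?A s + 2 * s * (eval_fps (composition_sum e r n) s / (1 - e * s\<^sup>2))"
    using radius eval_fps_nested_sum_step[OF radius_ge_1 e_le \<open>\<bar>s\<bar> < 1\<close>]
    by (simp add: eval_fps_add)
  ultimately show ?thesis
    using s_bounds by (simp add: composition_sum_Suc_Suc distrib_left)
qed

text \<open>The coefficient of \<open>t ^ q\<close> in the product of \<open>s powr - t\<close> with the generating function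
  \<open>\<Sum>i. composition_sum (-1) r (i + r) * t ^ i\<close>, evaluated at \<open>s\<close>.\<close>

definition composition_ln_conv :: "nat \<Rightarrow> nat \<Rightarrow> real \<Rightarrow> real" where
  "composition_ln_conv q r =
     exp_conv (\<lambda>s. - ln s) (\<lambda>i. eval_fps (composition_sum (-1) r (i + r))) q"

lemma composition_ln_conv_0: "composition_ln_conv q 0 s = divpow (- ln s) q"
proof -
  have "composition_ln_conv q 0 s = (\<Sum>i\<le>q. (if i = 0 then 1 else 0) * divpow (- ln s) (q - i))"
    unfolding composition_ln_conv_def exp_conv_def
    by (intro sum.cong) (auto simp: composition_sum_0)
  then show ?thesis by (simp add: sum_delta_mult_divpow)
qed

lemma DERIV_composition_ln_conv:
  assumes "0 < s" "s < 1"
  shows "(composition_ln_conv q (Suc r) has_real_derivative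
           2 / (1 + s\<^sup>2) * composition_ln_conv q r s) (at s)"
proof -
  let ?C = "composition_sum (-1)"
  define G where "G i = 2 / (1 + s\<^sup>2) * eval_fps (?C r (i + r)) s" for i
  have deriv: "(eval_fps (?C (Suc r) (Suc n)) has_real_derivative
      1 / s * eval_fps (?C (Suc r) n) s + 2 / (1 + s\<^sup>2) * eval_fps (?C r n) s) (at s)" for n
    using DERIV_eval_fps_composition_sum[of "-1", OF _ assms, of r n] by simp
  have "(composition_ln_conv q (Suc r) has_real_derivative
      (\<Sum>i\<le>q. G i * divpow (- ln s) (q - i))) (at s)"
    unfolding composition_ln_conv_def
  proof (rule DERIV_exp_conv)
    show "(eval_fps (?C (Suc r) (0 + Suc r)) has_real_derivative G 0) (at s)"
      using deriv[of r] by (simp add: G_def composition_sum_eq_0)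
    show "(eval_fps (?C (Suc r) (Suc i + Suc r)) has_real_derivative
        1 / s * eval_fps (?C (Suc r) (i + Suc r)) s + G (Suc i)) (at s)" for i
      using deriv[of "Suc i + r"] by (simp add: G_def)
  qed (rule DERIV_minus_ln[OF \<open>0 < s\<close>])
  then show ?thesis
    by (simp add: composition_ln_conv_def exp_conv_def G_def sum_distrib_left mult.assoc)
qed

lemma tendsto_composition_ln_conv_at_right_0: "(composition_ln_conv q (Suc r) \<longlongrightarrow> 0) (at_right 0)"
  unfolding composition_ln_conv_def
proof (intro tendsto_exp_conv_0 tendsto_eval_fps_mult_ln_power_at_right_0 composition_sum_Suc_nth_0)
  show "0 < fps_conv_radius (composition_sum (-1) (Suc r) n)" for n
    using fps_conv_radius_composition_sum[of "-1" "Suc r" n] by (auto intro: less_le_trans[of _ 1])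
qed

lemma tendsto_composition_ln_conv_at_left_1:
  "(composition_ln_conv q r \<longlongrightarrow> suminf (($) (composition_sum (-1) r (q + r)))) (at_left 1)"
  unfolding composition_ln_conv_def
proof (rule tendsto_exp_conv_of_tendsto_0)
  show "(eval_fps (composition_sum (-1) r (i + r))
      \<longlongrightarrow> suminf (($) (composition_sum (-1) r (i + r)))) (at_left 1)" for i
    by (intro Abel_limit summable_composition_sum_alternating)
qed (rule tendsto_minus_ln_at_left_1)

theorem has_integral_ln_arctan_divpow:
  "((\<lambda>s. divpow (cayley_angle s) r * (2 / (1 + s\<^sup>2) * divpow (- ln s) q))
     has_integral suminf (($) (composition_sum (-1) (Suc r) (q + Suc r)))) {0<..<1}"
proof (rule has_integral_divpow_mult)
  let ?F = "\<lambda>i. composition_ln_conv q (Suc i)"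
  show "(cayley_angle has_real_derivative - (2 / (1 + s\<^sup>2))) (at s)" for s
    by (rule DERIV_cayley_angle)
  show "(?F 0 has_real_derivative 2 / (1 + s\<^sup>2) * divpow (- ln s) q) (at s)"
    if "s \<in> {0<..<1}" for s
    using DERIV_composition_ln_conv[of s q 0] that by (simp add: composition_ln_conv_0)
  show "(?F (Suc i) has_real_derivative 2 / (1 + s\<^sup>2) * ?F i s) (at s)" if "s \<in> {0<..<1}" for i s
    using DERIV_composition_ln_conv[of s q "Suc i"] that by simp
  have "((\<lambda>s. ?F i s * cayley_angle s ^ n) \<longlongrightarrow> 0 * cayley_angle 0 ^ n) (at_right 0)" for i n
    by (intro tendsto_intros tendsto_composition_ln_conv_at_right_0 tendsto_cayley_angle)
  then show "((\<lambda>s. ?F i s * cayley_angle s ^ n) \<longlongrightarrow> 0) (at_right 0)" for i n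
    by simp
  show "(cayley_angle \<longlongrightarrow> 0) (at_left 1)"
    using tendsto_cayley_angle[of 1] by simp
  show "(?F i \<longlongrightarrow> suminf (($) (composition_sum (-1) (Suc i) (q + Suc i)))) (at_left 1)" for i
    by (rule tendsto_composition_ln_conv_at_left_1)
qed simp

section \<open>Moments of powers of the logarithm\<close>

definition eta_fps :: "nat \<Rightarrow> real fps" where
  "eta_fps i = fps_polylog i (fps_X * inverse (1 + fps_X))"

lemma eta_fps_nth_0: "eta_fps i $ 0 = 0"
  by (simp add: eta_fps_def)

lemma eta_fps_nth_Suc: "eta_fps i $ Suc k = (-1) ^ k / real (Suc k) ^ i"
  by (simp add: eta_fps_def fps_inverse_fps_X_plus1 del: of_nat_Suc)

lemma fps_conv_radius_eta: "1 \<le> fps_conv_radius (eta_fps i)"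
proof (rule fps_conv_radius_ge_1I)
  show "norm (eta_fps i $ k) \<le> 1" for k
    by (cases k)
       (auto simp: eta_fps_nth_0 eta_fps_nth_Suc abs_divide power_abs simp del: of_nat_Suc)
qed

lemma eval_fps_eta_0:
  assumes "\<bar>s\<bar> < 1"
  shows "eval_fps (eta_fps 0) s = s / (1 + s)"
proof -
  have "(\<lambda>k. s * (- s) ^ k) sums (s * (1 / (1 - - s)))"
    using assms by (intro sums_mult geometric_sums) simp
  then have "(\<lambda>k. eta_fps 0 $ Suc k * s ^ Suc k) sums (s / (1 + s))"
    by (simp add: eta_fps_nth_Suc power_minus[of s] mult_ac)
  then have "(\<lambda>k. eta_fps 0 $ k * s ^ k) sums (s / (1 + s))"
    by (subst (asm) sums_Suc_iff) (simp add: eta_fps_nth_0)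
  then show ?thesis
    by (simp add: eval_fps_def sums_iff)
qed

lemma summable_eta_fps: "summable (($) (eta_fps (Suc i)))"
proof -
  have "summable (\<lambda>k. (-1) ^ k * (1 / real (Suc k) ^ Suc i))"
  proof (rule summable_Leibniz(1))
    show "(\<lambda>k. 1 / real (Suc k) ^ Suc i) \<longlonglongrightarrow> 0" by real_asymp
    show "monoseq (\<lambda>k. 1 / real (Suc k) ^ Suc i)"
      by (intro decseq_imp_monoseq decseq_SucI divide_left_mono power_mono mult_pos_pos) auto
  qed
  then have "summable (\<lambda>k. eta_fps (Suc i) $ Suc k)"
    by (simp add: eta_fps_nth_Suc del: power_Suc of_nat_Suc)
  then show ?thesis by (simp only: summable_Suc_iff)
qed

lemma suminf_eta_fps: "suminf (($) (eta_fps (Suc i))) = zetabar (Suc i)"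
  using suminf_split_head[OF summable_eta_fps, of i]
  by (simp add: zetabar_def eta_fps_nth_0 eta_fps_nth_Suc del: power_Suc of_nat_Suc)

lemma tendsto_eval_fps_eta: "(eval_fps (eta_fps i) \<longlongrightarrow> zetabar i) (at_left 1)"
proof (cases i)
  case 0
  have "\<forall>\<^sub>F s in at_left 1. s \<in> {0<..<1::real}"
    by (rule eventually_at_left_real) simp
  then have "\<forall>\<^sub>F s in at_left 1. s / (1 + s) = eval_fps (eta_fps 0) s"
    by (rule eventually_mono) (simp add: eval_fps_eta_0)
  moreover have "((\<lambda>s. s / (1 + s)) \<longlongrightarrow> 1 / (1 + 1)) (at_left (1::real))"
    by (intro tendsto_intros) auto
  ultimately show ?thesis
    using Lim_transform_eventually by (fastforce simp: 0 zetabar_def)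
next
  case (Suc j)
  then show ?thesis
    using Abel_limit[OF summable_eta_fps, of j] by (simp add: suminf_eta_fps)
qed

lemma has_integral_ln_divpow_zetabar:
  "((\<lambda>s. divpow (- ln s) q * (1 / (1 + s)\<^sup>2)) has_integral zetabar q) {0<..<1}"
proof (rule has_integral_divpow_mult)
  show "(eval_fps (eta_fps 0) has_real_derivative 1 / (1 + s)\<^sup>2) (at s)"
    if s_in: "s \<in> {0<..<1}" for s
  proof -
    have "((\<lambda>s. s / (1 + s)) has_real_derivative 1 / (1 + s)\<^sup>2) (at s)"
      using s_in by (auto intro!: derivative_eq_intros simp: power2_eq_square)
    then show ?thesis
      by (rule has_field_derivative_transform_within_open[where S = "{0<..<1}"])
         (use s_in in \<open>auto simp: eval_fps_eta_0\<close>)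
  qed
  show "(eval_fps (eta_fps (Suc i)) has_real_derivative 1 / s * eval_fps (eta_fps i) s) (at s)"
    if s_in: "s \<in> {0<..<1}" for i s
    using s_in less_fps_conv_radius[OF fps_conv_radius_eta, of s 0] unfolding eta_fps_def
    by (intro DERIV_eval_fps_polylog) auto
  have "0 < fps_conv_radius (eta_fps i)" for i
    using fps_conv_radius_eta[of i] by (rule less_le_trans[rotated]) simp
  then show "((\<lambda>s. eval_fps (eta_fps i) s * (- ln s) ^ n) \<longlongrightarrow> 0) (at_right 0)" for i n
    by (intro tendsto_eval_fps_mult_ln_power_at_right_0 eta_fps_nth_0)
  show "(eval_fps (eta_fps i) \<longlongrightarrow> zetabar i) (at_left 1)" for i
    by (rule tendsto_eval_fps_eta)
qed (simp_all add: DERIV_minus_ln tendsto_minus_ln_at_left_1)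

text \<open>For odd \<open>r\<close> and \<open>k = 2 n - 1\<close> the coefficient \<open>T_fps 1 r $ k\<close> is \<open>T_n({1}_r)\<close>.\<close>

definition T_fps :: "real \<Rightarrow> nat \<Rightarrow> real fps" where
  "T_fps e r = two_step_sum e (nested_sum e (replicate r 1))"

lemma T_fps_0_nth_0 [simp]: "T_fps e 0 $ 0 = 1"
  and T_fps_Suc_nth_0 [simp]: "T_fps e (Suc r) $ 0 = 0"
  by (simp_all add: T_fps_def)

lemma T_fps_nth_Suc:
  "T_fps e r $ Suc k = (if k = 0 then 0 else e * T_fps e r $ (k - 1))
     + (if r = 0 then 0 else 2 / real (Suc k) * T_fps e (r - 1) $ k)"
  by (cases k; cases r) (simp_all add: T_fps_def)

lemma T_fps_nth_parity: "odd (k + r) \<Longrightarrow> T_fps e r $ k = 0"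
  unfolding T_fps_def by (intro two_step_sum_nth_parity[of r]) (auto intro: nested_sum_nth_parity)

lemma T_fps_nth_sign: "T_fps (-1) r $ k = (-1) ^ ((k + r) div 2 + r) * T_fps 1 r $ k"
  unfolding T_fps_def using nested_sum_nth_sign[of "replicate r 1"]
  by (intro two_step_sum_nth_sign) simp

definition T_zetabar_conv :: "nat \<Rightarrow> nat \<Rightarrow> real" where
  "T_zetabar_conv q k = (\<Sum>i\<le>q. 2 * zetabar (q - i) * T_fps 1 i $ k)"

lemma T_zetabar_conv_0: "T_zetabar_conv q 0 = 2 * zetabar q"
proof -
  have "T_fps 1 i $ 0 = (if i = 0 then 1 else 0)" for i
    by (cases i) auto
  then show ?thesis
    unfolding T_zetabar_conv_def by (subst sum.mono_neutral_right[of _ "{0}"]) auto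
qed

lemma T_zetabar_conv_Suc:
  "T_zetabar_conv q (Suc k) = (if k = 0 then 0 else T_zetabar_conv q (k - 1))
     + (if q = 0 then 0 else 2 / real (Suc k) * T_zetabar_conv (q - 1) k)"
proof -
  let ?lower = "\<lambda>i. if i = 0 then 0 else 2 / real (Suc k) * T_fps 1 (i - 1) $ k"
  have "T_zetabar_conv q (Suc k) = (if k = 0 then 0 else T_zetabar_conv q (k - 1))
      + (\<Sum>i\<le>q. 2 * zetabar (q - i) * ?lower i)"
    by (simp add: T_zetabar_conv_def T_fps_nth_Suc distrib_left sum.distrib del: of_nat_Suc)
  also have "(\<Sum>i\<le>q. 2 * zetabar (q - i) * ?lower i) =
      (if q = 0 then 0 else 2 / real (Suc k) * T_zetabar_conv (q - 1) k)"
    by (cases q) (simp_all add: T_zetabar_conv_def sum.atMost_Suc_shift sum_distrib_left mult_ac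
        del: sum.atMost_Suc of_nat_Suc)
  finally show ?thesis .
qed

text \<open>The integrand of \<open>\<integral>\<^sub>0\<^sup>1 (k + 1) x ^ k (- ln s) ^ q / q! dx\<close> after the substitution
  \<open>x = cayley s\<close>.\<close>

definition cayley_moment :: "nat \<Rightarrow> nat \<Rightarrow> real \<Rightarrow> real" where
  "cayley_moment k q s = real (Suc k) * cayley s ^ k * divpow (- ln s) q * (2 / (1 + s)\<^sup>2)"

lemma DERIV_cayley_power:
  assumes "0 < s"
  shows "((\<lambda>s. (1 - (cayley s)\<^sup>2) * cayley s ^ k) has_real_derivative
     2 / (1 + s)\<^sup>2 * (real (k + 2) * cayley s ^ Suc k
       - (if k = 0 then 0 else real k * cayley s ^ (k - 1)))) (at s)"
proof -
  have "(\<lambda>s. (1 - (cayley s)\<^sup>2) * cayley s ^ k) = (\<lambda>s. cayley s ^ k - cayley s ^ (k + 2))"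
    by (simp add: fun_eq_iff algebra_simps power2_eq_square)
  moreover note DERIV_diff[OF DERIV_power[OF DERIV_cayley[OF assms], of k]
      DERIV_power[OF DERIV_cayley[OF assms], of "k + 2"]]
  ultimately show ?thesis
    by (simp only:) (erule DERIV_cong, cases k, simp_all add: algebra_simps add_divide_distrib)
qed

lemma DERIV_cayley_power_divpow:
  assumes "0 < s"
  shows "((\<lambda>s. (1 - (cayley s)\<^sup>2) * cayley s ^ k * divpow (- ln s) q) has_real_derivative
     cayley_moment (Suc k) q s - (if k = 0 then 0 else cayley_moment (k - 1) q s)
       - (if q = 0 then 0 else 2 / real (Suc k) * cayley_moment k (q - 1) s)) (at s)"
proof -
  define c w where "c = cayley s" and "w = 2 / (1 + s)\<^sup>2"
  define L where "L = divpow (- ln s) q"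
  define L' where "L' = (if q = 0 then 0 else divpow (- ln s) (q - 1))"
  have "((\<lambda>s. divpow (- ln s) q) has_real_derivative - (1 / s) * L') (at s)"
    using DERIV_divpow[OF DERIV_minus_ln[OF assms], of "q - 1"] by (cases q) (auto simp: L'_def)
  from DERIV_mult'[OF DERIV_cayley_power[OF assms, of k] this]
  have "((\<lambda>s. (1 - (cayley s)\<^sup>2) * cayley s ^ k * divpow (- ln s) q) has_real_derivative
      2 * s * w * c ^ k * (- (1 / s) * L')
        + w * (real (k + 2) * c ^ Suc k - (if k = 0 then 0 else real k * c ^ (k - 1))) * L) (at s)"
    by (simp only: one_minus_cayley_square[OF assms] c_def w_def L_def)
  also have "2 * s * w * c ^ k * (- (1 / s) * L')
        + w * (real (k + 2) * c ^ Suc k - (if k = 0 then 0 else real k * c ^ (k - 1))) * L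
      = real (Suc (Suc k)) * c ^ Suc k * L * w
          - (if k = 0 then 0 else real (Suc (k - 1)) * c ^ (k - 1) * L * w)
          - 2 / real (Suc k) * (real (Suc k) * c ^ k * L' * w)"
  proof -
    have "2 / real (Suc k) * (real (Suc k) * c ^ k * L' * w) = 2 * s * w * c ^ k * (1 / s * L')"
      using assms by (simp del: of_nat_Suc)
    then show ?thesis by (simp add: algebra_simps)
  qed
  finally show ?thesis
    by (cases q)
       (simp_all only: cayley_moment_def c_def w_def L_def L'_def if_True if_False, simp_all)
qed

lemma has_integral_cayley_moment_rec:
  assumes "0 < k \<or> 0 < q"
  shows "((\<lambda>s. cayley_moment (Suc k) q s - (if k = 0 then 0 else cayley_moment (k - 1) q s)
       - (if q = 0 then 0 else 2 / real (Suc k) * cayley_moment k (q - 1) s))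
     has_integral 0) {0<..<1}"
proof -
  define H where "H = (\<lambda>s. (1 - (cayley s)\<^sup>2) * cayley s ^ k * divpow (- ln s) q)"
  have "(H \<longlongrightarrow> (1 - 0\<^sup>2) * 0 ^ k * divpow (- ln 1) q) (at_left 1)"
    unfolding H_def by (intro tendsto_intros tendsto_cayley_at_left_1) auto
  then have lim_1: "(H \<longlongrightarrow> 0) (at_left 1)"
    using assms by (auto simp: divpow_0_left power_0_left split: if_splits)
  let ?H = "\<lambda>s. 4 / (1 + s)\<^sup>2 * cayley s ^ k * (s * (- ln s) ^ q) / fact q"
  have "(?H \<longlongrightarrow> 4 / (1 + 0)\<^sup>2 * 1 ^ k * 0 / fact q) (at_right 0)"
    by (intro tendsto_intros tendsto_cayley_at_right_0 tendsto_mult_ln_power_at_right_0) auto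
  then have "(?H \<longlongrightarrow> 0) (at_right 0)"
    by simp
  moreover have "\<forall>\<^sub>F s in at_right 0. ?H s = H s"
    using eventually_at_right_less[of "0::real"]
    by (rule eventually_mono) (simp add: H_def one_minus_cayley_square divpow_def mult_ac)
  ultimately have lim_0: "(H \<longlongrightarrow> 0) (at_right 0)"
    by (rule Lim_transform_eventually)
  show ?thesis
    using has_integral_Ioo_of_limits[OF zero_less_one _ lim_0 lim_1] DERIV_cayley_power_divpow
    by (simp add: H_def)
qed

text \<open>The parity condition is needed: if \<open>k\<close> and \<open>q\<close> have different parity, then the recursion leads
  to the boundary term for \<open>k = q = 0\<close>, which does not vanish.\<close>

theorem has_integral_cayley_moment:
  "even (k + q) \<Longrightarrow> (cayley_moment k q has_integral T_zetabar_conv q k) {0<..<1}"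
proof (induction k arbitrary: q rule: less_induct)
  case (less k)
  show ?case
  proof (cases k)
    case 0
    have "((\<lambda>s. 2 * (divpow (- ln s) q * (1 / (1 + s)\<^sup>2))) has_integral 2 * zetabar q) {0<..<1}"
      by (intro has_integral_mult_right has_integral_ln_divpow_zetabar)
    then show ?thesis
      by (simp add: 0 T_zetabar_conv_0 cayley_moment_def[abs_def] mult_ac)
  next
    case (Suc j)
    have lower_power: "((\<lambda>s. if j = 0 then 0 else cayley_moment (j - 1) q s) has_integral
        (if j = 0 then 0 else T_zetabar_conv q (j - 1))) {0<..<1}"
      using less.IH[of "j - 1" q] less.prems Suc by auto
    have lower_log: "((\<lambda>s. if q = 0 then 0 else 2 / real (Suc j) * cayley_moment j (q - 1) s)
        has_integral (if q = 0 then 0 else 2 / real (Suc j) * T_zetabar_conv (q - 1) j)) {0<..<1}"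
      using has_integral_mult_right[OF less.IH[of j "q - 1"], of "2 / real (Suc j)"] less.prems Suc
      by (cases q) auto
    have "0 < j \<or> 0 < q" using less.prems Suc by (auto intro!: Nat.gr0I)
    from has_integral_add[OF has_integral_add[OF has_integral_cayley_moment_rec[OF this] lower_log]
        lower_power]
    show ?thesis
      unfolding Suc T_zetabar_conv_Suc diff_add_cancel by (simp only: add_0 add.commute)
  qed
qed

section \<open>Termwise integration\<close>

lemma sums_integral_of_dominated:
  fixes f :: "nat \<Rightarrow> 'n::euclidean_space \<Rightarrow> 'm::euclidean_space"
  assumes f_integral: "\<And>k. (f k has_integral c k) S" and h_integrable: "h integrable_on S"
    and bound: "\<And>n x. x \<in> S \<Longrightarrow> norm (\<Sum>k<n. f k x) \<le> h x"
    and sums: "\<And>x. x \<in> S \<Longrightarrow> (\<lambda>k. f k x) sums g x"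
  shows "c sums integral S g"
proof -
  have partial_sums: "((\<lambda>x. \<Sum>k<n. f k x) has_integral (\<Sum>k<n. c k)) S" for n
    by (intro has_integral_sum f_integral) auto
  have "(\<lambda>n. integral S (\<lambda>x. \<Sum>k<n. f k x)) \<longlonglongrightarrow> integral S g"
    by (rule dominated_convergence(2)[OF has_integral_integrable[OF partial_sums]
          h_integrable bound])
       (use sums in \<open>auto simp: sums_def\<close>)
  then show ?thesis
    by (simp add: sums_def integral_unique[OF partial_sums])
qed

lemma abs_sum_two_step_sum_le:
  assumes A_le_B: "\<And>k. \<bar>A $ k\<bar> \<le> B $ k" and radius: "1 \<le> fps_conv_radius B"
    and x_bounds: "0 \<le> x" "x < 1"
  shows "\<bar>\<Sum>k<n. two_step_sum (-1) A $ k * x ^ k\<bar> \<le> 3 * eval_fps B x"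
proof -
  let ?c = "\<lambda>k. two_step_sum (-1) A $ k * x ^ k"
  have B_nonneg: "0 \<le> B $ k" for k using A_le_B[of k] by linarith
  have sum_le: "(\<Sum>k\<in>I. B $ k * x ^ k) \<le> eval_fps B x" if "finite I" for I
    unfolding eval_fps_def using that B_nonneg x_bounds less_fps_conv_radius[OF radius, of x]
    by (intro sum_le_suminf summable_fps) auto
  have term_le: "\<bar>?c k\<bar> \<le> eval_fps B x" for k
  proof -
    have "\<bar>?c k\<bar> \<le> two_step_sum 1 B $ k * x ^ k"
      using x_bounds abs_two_step_sum_nth_le[of "-1", OF _ A_le_B]
      by (auto simp: abs_mult intro: mult_right_mono)
    also have "\<dots> \<le> (\<Sum>j\<le>k. B $ j * x ^ j)"
      using B_nonneg x_bounds by (intro two_step_sum_nth_mult_power_le) auto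
    finally show ?thesis using sum_le[of "{..k}"] by simp
  qed
  consider "n = 0" | "n = 1" | m where "n = Suc (Suc m)"
    by (metis One_nat_def old.nat.exhaust)
  then show ?thesis
  proof cases
    case 3
    have "\<bar>\<Sum>k<n. A $ k * x ^ k\<bar> \<le> (\<Sum>k<n. B $ k * x ^ k)"
      using A_le_B x_bounds
      by (intro order_trans[OF sum_abs sum_mono]) (auto simp: abs_mult intro!: mult_right_mono)
    moreover have "\<bar>x\<^sup>2 * (?c m + ?c (Suc m))\<bar> \<le> 1 * (2 * eval_fps B x)"
      unfolding abs_mult[of "x\<^sup>2"] using x_bounds term_le[of m] term_le[of "Suc m"]
      by (intro mult_mono) (auto intro: power_le_one)
    ultimately have "\<bar>(1 - - 1 * x\<^sup>2) * (\<Sum>k<n. ?c k)\<bar> \<le> 3 * eval_fps B x"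
      unfolding 3 sum_two_step_sum_nth using sum_le[of "{..<n}"] 3 by simp
    moreover have "1 * \<bar>\<Sum>k<n. ?c k\<bar> \<le> \<bar>(1 - - 1 * x\<^sup>2) * (\<Sum>k<n. ?c k)\<bar>"
      unfolding abs_mult by (intro mult_right_mono) auto
    ultimately show ?thesis by simp
  qed (use term_le[of 0] in auto)
qed

lemma eval_fps_nested_sum_cayley_ln:
  assumes s_bounds: "0 < s" "s < 1"
  shows "eval_fps (nested_sum 1 (replicate r 1)) (cayley s) = divpow (- ln s) r"
proof -
  let ?h = "\<lambda>x::real. ln (1 + x) - ln (1 - x)"
  have "eval_fps (nested_sum 1 (replicate r 1)) (cayley s) = divpow (?h (cayley s)) r"
  proof (rule eval_fps_nested_sum_replicate_1)
    fix x :: real assume "\<bar>x\<bar> < 1"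
    then have pos: "0 < 1 + x" "0 < 1 - x" by auto
    then have "(?h has_real_derivative 1 / (1 + x) + 1 / (1 - x)) (at x)"
      by (auto intro!: derivative_eq_intros)
    also have "1 / (1 + x) + 1 / (1 - x) = 2 / (1 - 1 * x\<^sup>2)"
      using pos by (subst add_frac_eq) (auto simp: power2_eq_square algebra_simps)
    finally show "(?h has_real_derivative 2 / (1 - 1 * x\<^sup>2)) (at x)" .
  qed (use cayley_bounds[OF s_bounds] in auto)
  then show ?thesis by (simp add: ln_one_minus_cayley[OF s_bounds])
qed

lemma eval_fps_nested_sum_cayley_arctan:
  assumes s_bounds: "0 < s" "s < 1"
  shows "eval_fps (nested_sum (-1) (replicate r 1)) (cayley s) = divpow (cayley_angle s) r"
  unfolding arctan_cayley[OF s_bounds, symmetric]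
proof (rule eval_fps_nested_sum_replicate_1)
  fix x :: real
  have "((\<lambda>x. 2 * arctan x) has_real_derivative 2 * inverse (1 + x\<^sup>2)) (at x)"
    by (intro DERIV_cmult DERIV_arctan)
  then show "((\<lambda>x. 2 * arctan x) has_real_derivative 2 / (1 - - 1 * x\<^sup>2)) (at x)"
    by (simp add: divide_inverse)
qed (use cayley_bounds[OF s_bounds] in auto)

lemma T_fps_partial_sum_le:
  assumes s_bounds: "0 < s" "s < 1"
  shows "\<bar>\<Sum>k<n. T_fps (-1) r $ k * cayley s ^ k\<bar> \<le> 3 * divpow (- ln s) r"
  unfolding T_fps_def eval_fps_nested_sum_cayley_ln[OF s_bounds, symmetric]
  using cayley_bounds[OF s_bounds]
  by (intro abs_sum_two_step_sum_le abs_nested_sum_nth_le fps_conv_radius_nested_sum) auto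

lemma T_fps_cayley_sums:
  assumes s_bounds: "0 < s" "s < 1"
  shows "(\<lambda>k. T_fps (-1) r $ k * cayley s ^ k) sums
           (divpow (cayley_angle s) r / (1 + (cayley s)\<^sup>2))"
proof -
  have cayley_less: "\<bar>cayley s\<bar> < 1" using cayley_bounds[OF s_bounds] by simp
  have radius: "1 \<le> fps_conv_radius (nested_sum (-1) (replicate r 1))"
    by (rule fps_conv_radius_nested_sum) simp
  then have "1 \<le> fps_conv_radius (T_fps (-1) r)"
    unfolding T_fps_def by (intro fps_conv_radius_two_step_sum) auto
  then have "(\<lambda>k. T_fps (-1) r $ k * cayley s ^ k) sums eval_fps (T_fps (-1) r) (cayley s)"
    using cayley_less by (intro sums_eval_fps less_fps_conv_radius)
  then show ?thesis
    using eval_fps_two_step_sum[OF radius _ cayley_less]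
      eval_fps_nested_sum_cayley_arctan[OF s_bounds, of r]
    by (simp add: T_fps_def)
qed

definition ln_weight :: "nat \<Rightarrow> real \<Rightarrow> real" where
  "ln_weight q s = 4 * divpow (- ln s) q / (1 + s)\<^sup>2"

lemma ln_weight_nonneg: "s \<in> {0<..<1} \<Longrightarrow> 0 \<le> ln_weight q s"
  by (simp add: ln_weight_def divpow_nonneg)

lemma integrable_divpow_mult_ln_weight:
  "(\<lambda>s. 3 * divpow (- ln s) r * ln_weight q s) integrable_on {0<..<1}"
proof -
  have "3 * divpow (- ln s) r * ln_weight q s =
      12 * real (r + q choose r) * (divpow (- ln s) (r + q) * (1 / (1 + s)\<^sup>2))" for s
    using divpow_mult[of "- ln s" r q] by (simp add: ln_weight_def)
  moreover have "(\<lambda>s. 12 * real (r + q choose r) * (divpow (- ln s) (r + q) * (1 / (1 + s)\<^sup>2)))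
      integrable_on {0<..<1}"
    by (intro integrable_on_mult_right has_integral_integrable[OF has_integral_ln_divpow_zetabar])
  ultimately show ?thesis by (simp only:)
qed

lemma has_integral_T_fps_cayley_power:
  assumes "odd r" "odd q"
  shows "((\<lambda>s. T_fps (-1) r $ k * cayley s ^ k * ln_weight q s) has_integral
           T_fps (-1) r $ k * (2 / real (Suc k)) * T_zetabar_conv q k) {0<..<1}"
proof (cases "even (k + q)")
  case True
  have "T_fps (-1) r $ k * cayley s ^ k * ln_weight q s =
      T_fps (-1) r $ k * (2 / real (Suc k)) * cayley_moment k q s" for s
    by (simp add: cayley_moment_def ln_weight_def del: of_nat_Suc)
  then show ?thesis
    using has_integral_mult_right[OF has_integral_cayley_moment[OF True]] by (simp only:)
next
  case False
  then have "T_fps (-1) r $ k = 0" using assms by (intro T_fps_nth_parity) auto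
  then show ?thesis by simp
qed

lemma T_fps_cayley_ln_weight_sums:
  assumes s_bounds: "0 < s" "s < 1"
  shows "(\<lambda>k. T_fps (-1) r $ k * cayley s ^ k * ln_weight q s) sums
           (divpow (cayley_angle s) r * (2 / (1 + s\<^sup>2) * divpow (- ln s) q))"
proof -
  have "(\<lambda>k. T_fps (-1) r $ k * cayley s ^ k * ln_weight q s) sums
      (divpow (cayley_angle s) r / (1 + (cayley s)\<^sup>2) * ln_weight q s)"
    by (intro sums_mult2 T_fps_cayley_sums s_bounds)
  also have "divpow (cayley_angle s) r / (1 + (cayley s)\<^sup>2) * ln_weight q s =
      divpow (cayley_angle s) r * (2 * divpow (- ln s) q) * (2 / (1 + s)\<^sup>2 / (1 + (cayley s)\<^sup>2))"
    by (simp add: ln_weight_def mult_ac)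
  also have "\<dots> = divpow (cayley_angle s) r * (2 / (1 + s\<^sup>2) * divpow (- ln s) q)"
    unfolding one_plus_cayley_square[OF s_bounds(1)] by simp
  finally show ?thesis .
qed

theorem T_fps_mult_T_zetabar_conv_sums:
  assumes "odd r" "odd q"
  shows "(\<lambda>k. T_fps (-1) r $ k * (2 / real (Suc k)) * T_zetabar_conv q k) sums
           suminf (($) (composition_sum (-1) (Suc r) (q + Suc r)))"
proof -
  have "(\<lambda>k. T_fps (-1) r $ k * (2 / real (Suc k)) * T_zetabar_conv q k) sums
      integral {0<..<1} (\<lambda>s. divpow (cayley_angle s) r * (2 / (1 + s\<^sup>2) * divpow (- ln s) q))"
  proof (rule sums_integral_of_dominated[OF has_integral_T_fps_cayley_power[OF assms]
        integrable_divpow_mult_ln_weight])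
    fix s :: real assume s_in: "s \<in> {0<..<1}"
    show "norm (\<Sum>k<n. T_fps (-1) r $ k * cayley s ^ k * ln_weight q s)
        \<le> 3 * divpow (- ln s) r * ln_weight q s" for n
      using s_in T_fps_partial_sum_le[of s r n] ln_weight_nonneg[OF s_in, of q]
      by (auto simp: abs_mult simp flip: sum_distrib_right intro!: mult_right_mono)
  qed (rule T_fps_cayley_ln_weight_sums, auto)
  also have "integral {0<..<1} (\<lambda>s. divpow (cayley_angle s) r * (2 / (1 + s\<^sup>2) * divpow (- ln s) q))
      = suminf (($) (composition_sum (-1) (Suc r) (q + Suc r)))"
    by (rule integral_unique[OF has_integral_ln_arctan_divpow])
  finally show ?thesis .
qed

section \<open>Sums over chains\<close>

definition step_chains :: "(nat \<Rightarrow> nat) \<Rightarrow> nat \<Rightarrow> nat \<Rightarrow> nat list set" where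
  "step_chains d r n = {ns. length ns = r \<and> (\<forall>i<r. 0 < ns ! i \<and> ns ! i \<le> n) \<and>
      (\<forall>i. Suc i < r \<longrightarrow> ns ! i + d (Suc i) \<le> ns ! Suc i)}"

definition chain_sum :: "(nat \<Rightarrow> nat) \<Rightarrow> (nat \<Rightarrow> nat \<Rightarrow> real) \<Rightarrow> nat \<Rightarrow> nat \<Rightarrow> real" where
  "chain_sum d f r n = (\<Sum>ns\<in>step_chains d r n. \<Prod>i<r. f i (ns ! i))"

lemma finite_step_chains: "finite (step_chains d r n)"
proof (rule finite_subset)
  show "step_chains d r n \<subseteq> {ns. set ns \<subseteq> {..n} \<and> length ns = r}"
    by (auto simp: step_chains_def set_conv_nth)
qed (rule finite_lists_length_eq, simp)

lemma sorted_of_step_chains: "ns \<in> step_chains d r n \<Longrightarrow> sorted ns"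
  unfolding sorted_iff_nth_Suc by (auto simp: step_chains_def intro: add_leD1)

lemma chain_sum_0: "chain_sum d f 0 n = 1"
proof -
  have "step_chains d 0 n = {[]}" by (auto simp: step_chains_def)
  then show ?thesis by (simp add: chain_sum_def)
qed

lemma step_chains_snocI:
  assumes "0 < l" "l \<le> n" "ns \<in> step_chains d r (l - d r)"
  shows "ns @ [l] \<in> step_chains d (Suc r) n"
proof -
  have len: "length ns = r" and bounds: "\<And>i. i < r \<Longrightarrow> 0 < ns ! i \<and> ns ! i \<le> l - d r"
    and step: "\<And>i. Suc i < r \<Longrightarrow> ns ! i + d (Suc i) \<le> ns ! Suc i"
    using assms(3) by (auto simp: step_chains_def)
  have "ns ! i + d r \<le> l" if "i < r" for i
    using bounds[OF that] by linarith
  then show ?thesis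
    using assms(1,2) len bounds step
    by (fastforce simp: step_chains_def nth_append less_Suc_eq)
qed

lemma step_chains_snocD:
  assumes "ns @ [l] \<in> step_chains d (Suc r) n"
  shows "0 < l" "l \<le> n" "ns \<in> step_chains d r (l - d r)"
proof -
  have len: "length ns = r"
    using assms by (simp add: step_chains_def)
  have nth: "(ns @ [l]) ! i = (if i < r then ns ! i else l)" if "i \<le> r" for i
    using that len by (auto simp: nth_append)
  have bounds: "0 < (ns @ [l]) ! i \<and> (ns @ [l]) ! i \<le> n" if "i \<le> r" for i
    using assms that by (auto simp: step_chains_def less_Suc_eq_le)
  have step: "(ns @ [l]) ! i + d (Suc i) \<le> (ns @ [l]) ! Suc i" if "i < r" for i
    using assms that by (auto simp: step_chains_def)
  show "0 < l" "l \<le> n"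
    using bounds[of r] nth[of r] by auto
  have "ns ! i \<le> l - d r" if "i < r" for i
  proof -
    have "ns ! i \<le> ns ! (r - 1)"
      using sorted_of_step_chains[OF assms] that len
      by (intro sorted_nth_mono) (auto simp: sorted_append)
    moreover have "ns ! (r - 1) + d r \<le> l"
      using step[of "r - 1"] nth[of "r - 1"] nth[of r] that by simp
    ultimately show ?thesis by linarith
  qed
  moreover have "0 < ns ! i" if "i < r" for i
    using bounds[of i] nth[of i] that by auto
  moreover have "ns ! i + d (Suc i) \<le> ns ! Suc i" if "Suc i < r" for i
    using step[of i] nth[of i] nth[of "Suc i"] that by auto
  ultimately show "ns \<in> step_chains d r (l - d r)"
    using len by (simp add: step_chains_def)
qed

lemma snoc_in_step_chains_iff:
  "ns @ [l] \<in> step_chains d (Suc r) n \<longleftrightarrow> 0 < l \<and> l \<le> n \<and> ns \<in> step_chains d r (l - d r)"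
  by (auto intro: step_chains_snocI dest: step_chains_snocD)

lemma step_chains_Suc:
  "step_chains d (Suc r) n = (\<lambda>(l, ns). ns @ [l]) ` (SIGMA l:{1..n}. step_chains d r (l - d r))"
proof (intro equalityI subsetI)
  fix ms assume chain: "ms \<in> step_chains d (Suc r) n"
  then have "ms \<noteq> []" by (auto simp: step_chains_def)
  then obtain ns l where ms_eq: "ms = ns @ [l]" by (metis rev_exhaust)
  with chain show "ms \<in> (\<lambda>(l, ns). ns @ [l]) ` (SIGMA l:{1..n}. step_chains d r (l - d r))"
    by (force simp: snoc_in_step_chains_iff)
qed (auto simp: snoc_in_step_chains_iff)

lemma chain_sum_Suc: "chain_sum d f (Suc r) n = (\<Sum>l=1..n. f r l * chain_sum d f r (l - d r))"
proof -
  have "inj_on (\<lambda>(l, ns). ns @ [l]) (SIGMA l:{1..n}. step_chains d r (l - d r))"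
    by (auto simp: inj_on_def)
  then have "chain_sum d f (Suc r) n =
      (\<Sum>(l, ns)\<in>(SIGMA l:{1..n}. step_chains d r (l - d r)). \<Prod>i<Suc r. f i ((ns @ [l]) ! i))"
    unfolding chain_sum_def step_chains_Suc by (subst sum.reindex) (auto simp: case_prod_unfold)
  also have "\<dots> = (\<Sum>l=1..n. \<Sum>ns\<in>step_chains d r (l - d r). \<Prod>i<Suc r. f i ((ns @ [l]) ! i))"
    by (subst sum.Sigma) (auto simp: finite_step_chains)
  also have "\<dots> = (\<Sum>l=1..n. \<Sum>ns\<in>step_chains d r (l - d r). f r l * (\<Prod>i<r. f i (ns ! i)))"
    by (intro sum.cong refl) (simp add: step_chains_def nth_append)
  finally show ?thesis by (simp add: chain_sum_def sum_distrib_left)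
qed

section \<open>The sums T\<close>

lemma T_fps_0_nth_even: "T_fps 1 0 $ (2 * n) = 1"
  by (induction n) (simp_all add: T_fps_nth_Suc)

lemma sum_T_fps_even:
  "(\<Sum>l=1..n. 2 / (2 * real l - 1) * T_fps 1 r $ (2 * (l - 1))) = T_fps 1 (Suc r) $ (2 * n - 1)"
proof (induction n)
  case (Suc n)
  have "2 * real (Suc n) - 1 = real (Suc (2 * n))" "2 * Suc n - 1 = Suc (2 * n)"
    by simp_all
  moreover have "T_fps 1 (Suc r) $ (2 * n - 1) = 0" if "n = 0"
    using that by simp
  ultimately show ?case
    using Suc.IH by (simp add: T_fps_nth_Suc del: of_nat_Suc)
qed simp

lemma sum_T_fps_odd:
  "(\<Sum>l=1..n. 2 / (2 * real l) * T_fps 1 r $ (2 * l - 1)) = T_fps 1 (Suc r) $ (2 * n)"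
proof (induction n)
  case (Suc n)
  have "T_fps 1 (Suc r) $ Suc (Suc (2 * n)) =
      T_fps 1 (Suc r) $ (2 * n) + 2 / real (Suc (Suc (2 * n))) * T_fps 1 r $ Suc (2 * n)"
    by (simp add: T_fps_nth_Suc[of _ _ "Suc (2 * n)"])
  moreover have "2 * real (Suc n) = real (Suc (Suc (2 * n)))" "2 * Suc n = Suc (Suc (2 * n))"
    by simp_all
  ultimately show ?case
    using Suc.IH by (simp only: sum.nat_ivl_Suc' diff_Suc_1)
qed simp

abbreviation T_gap :: "nat \<Rightarrow> nat" where
  "T_gap i \<equiv> if even i then 1 else 0"

abbreviation T_factor :: "nat \<Rightarrow> nat \<Rightarrow> real" where
  "T_factor i n \<equiv> 2 / (if even i then 2 * real n - 1 else 2 * real n)"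

lemma chain_sum_eq_T_fps:
  "chain_sum T_gap T_factor r n = T_fps 1 r $ (if odd r then 2 * n - 1 else 2 * n)"
proof (induction r arbitrary: n)
  case 0
  show ?case by (simp add: chain_sum_0 T_fps_0_nth_even)
next
  case (Suc r)
  then show ?case
    unfolding chain_sum_Suc using sum_T_fps_even[of r n] sum_T_fps_odd[of r n]
    by (cases "odd r") simp_all
qed

lemma T_ones_eq_T_fps:
  assumes "1 \<le> a"
  shows "T_ones (Suc n) a = T_fps 1 (2 * a - 1) $ (2 * n + 1)"
proof -
  have "T_chains (Suc n) a = step_chains T_gap (2 * a - 1) (Suc n)"
    by (auto simp: T_chains_def step_chains_def)
  then have "T_ones (Suc n) a = chain_sum T_gap T_factor (2 * a - 1) (Suc n)"
    unfolding T_ones_def chain_sum_def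
    by (intro sum.cong) (auto simp: step_chains_def prod_dividef)
  also have "\<dots> = T_fps 1 (2 * a - 1) $ (2 * n + 1)"
    unfolding chain_sum_eq_T_fps using assms by simp
  finally show ?thesis .
qed

section \<open>The series W\<close>

abbreviation Tbar_factor :: "(nat \<Rightarrow> nat) \<Rightarrow> nat \<Rightarrow> nat \<Rightarrow> real" where
  "Tbar_factor c i n \<equiv> 2 / (2 * real n - real (Suc i)) ^ c i"

text \<open>Truncated subtraction of indices is harmless, because the coefficient at \<open>0\<close> vanishes.\<close>

lemma sum_nested_sum_nth:
  assumes "0 < length cs"
  shows "(\<Sum>l=1..n. nested_sum 1 cs $ (2 * l - length cs)) =
           two_step_sum 1 (nested_sum 1 cs) $ (2 * n - length cs)"
proof (induction n)
  case 0
  show ?case using assms by (simp add: nested_sum_nth_eq_0)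
next
  case (Suc n)
  let ?S = "($) (two_step_sum 1 (nested_sum 1 cs))"
  have "?S (2 * Suc n - length cs) =
      ?S (2 * n - length cs) + nested_sum 1 cs $ (2 * Suc n - length cs)"
  proof (cases "length cs \<le> 2 * n")
    case True
    then have "2 * Suc n - length cs = Suc (Suc (2 * n - length cs))" by simp
    then show ?thesis by simp
  next
    case False
    then have "2 * n - length cs = 0" "2 * Suc n - length cs \<in> {0, Suc 0}" by auto
    then show ?thesis using assms by (auto simp: nested_sum_nth_eq_0)
  qed
  then show ?case using Suc.IH by simp
qed

lemma Tbar_factor_mult_two_step_sum:
  assumes "length cs = r" "1 \<le> l"
  shows "Tbar_factor c r l * two_step_sum 1 (nested_sum 1 cs) $ (2 * (l - 1) - r) =
           nested_sum 1 (c r # cs) $ (2 * l - Suc r)"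
proof (cases "r < l")
  case True
  then have "2 * l - Suc r = Suc (2 * (l - 1) - r)"
    "2 * real l - real (Suc r) = real (2 * l - Suc r)"
    by (simp_all add: of_nat_diff)
  then show ?thesis
    by (simp only: nested_sum_Cons_nth_Suc times_divide_eq_left)
next
  case False
  have "two_step_sum 1 (nested_sum 1 cs) $ (2 * (l - 1) - r) = 0"
    using False assms by (intro two_step_sum_nth_eq_0 nested_sum_nth_eq_0) auto
  moreover have "nested_sum 1 (c r # cs) $ (2 * l - Suc r) = 0"
    using False assms by (intro nested_sum_nth_eq_0) auto
  ultimately show ?thesis by simp
qed

lemma chain_sum_eq_two_step_sum:
  "chain_sum (\<lambda>_. 1) (Tbar_factor c) r n =
     two_step_sum 1 (nested_sum 1 (rev (map c [0..<r]))) $ (2 * n - r)"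
proof (induction r arbitrary: n)
  case 0
  have "two_step_sum 1 1 $ (2 * n) = 1" by (induction n) auto
  then show ?case by (simp add: chain_sum_0)
next
  case (Suc r)
  let ?cs = "rev (map c [0..<r])"
  have "chain_sum (\<lambda>_. 1) (Tbar_factor c) (Suc r) n =
      (\<Sum>l=1..n. nested_sum 1 (c r # ?cs) $ (2 * l - Suc r))"
    unfolding chain_sum_Suc Suc.IH by (intro sum.cong Tbar_factor_mult_two_step_sum) auto
  also have "\<dots> = two_step_sum 1 (nested_sum 1 (c r # ?cs)) $ (2 * n - Suc r)"
    using sum_nested_sum_nth[of "c r # ?cs" n] by (simp del: nested_sum.simps)
  finally show ?case by simp
qed

lemma strict_chains_eq_step_chains:
  "{ns. length ns = Suc r \<and> sorted_wrt (<) ns \<and> (\<forall>i<length ns. 0 < ns ! i) \<and> ns \<noteq> [] \<and> last ns = N}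
     = {ns \<in> step_chains (\<lambda>_. 1) (Suc r) N. last ns = N}" (is "?strict = ?step")
proof (intro equalityI subsetI)
  fix ns assume "ns \<in> ?strict"
  then have len: "length ns = Suc r" and strict: "sorted_wrt (<) ns"
    and pos: "\<forall>i<length ns. 0 < ns ! i" and last: "ns ! r = N" "last ns = N"
    by (auto simp: last_conv_nth)
  have "ns ! i \<le> N" if "i < Suc r" for i
    using strict that len last(1) sorted_nth_mono[of ns i r] by (auto simp: strict_sorted_iff)
  then show "ns \<in> ?step"
    using len strict pos last(2)
    by (auto simp: step_chains_def sorted_wrt_iff_nth_Suc_transp Suc_le_eq)
qed (auto simp: step_chains_def sorted_wrt_iff_nth_Suc_transp Suc_le_eq)

lemma step_chains_last_eq:
  assumes "0 < n"
  shows "{ns \<in> step_chains d (Suc r) n. last ns = n} = (\<lambda>ns. ns @ [n]) ` step_chains d r (n - d r)"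
proof (intro equalityI subsetI)
  fix ns assume ns_in: "ns \<in> {ns \<in> step_chains d (Suc r) n. last ns = n}"
  then have "ns = butlast ns @ [n]"
    by (auto simp: step_chains_def intro: append_butlast_last_id[symmetric])
  with ns_in show "ns \<in> (\<lambda>ns. ns @ [n]) ` step_chains d r (n - d r)"
    using snoc_in_step_chains_iff by (metis (no_types, lifting) image_eqI mem_Collect_eq)
qed (use assms in \<open>auto simp: snoc_in_step_chains_iff\<close>)

lemma Tbar_inner_eq_nested_sum:
  assumes "ks \<noteq> []"
  shows "2 ^ length ks * Tbar_inner ks N = (-1) ^ N * nested_sum 1 (rev ks) $ (2 * N - length ks)"
proof -
  obtain r where length_ks: "length ks = Suc r" using assms by (cases ks) auto
  let ?c = "\<lambda>i. ks ! i" and ?C = "{ns \<in> step_chains (\<lambda>_. 1) (Suc r) N. last ns = N}"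
  have factors: "2 ^ length ks *
        ((-1) ^ N / (\<Prod>j<length ks. (2 * real (ns ! j) - real (Suc j)) ^ (ks ! j)))
      = (-1) ^ N * (\<Prod>j<Suc r. Tbar_factor ?c j (ns ! j))" for ns
    by (simp only: prod_dividef prod_constant card_lessThan length_ks) simp
  have inner: "2 ^ length ks * Tbar_inner ks N =
      (-1) ^ N * (\<Sum>ns\<in>?C. \<Prod>j<Suc r. Tbar_factor ?c j (ns ! j))"
    unfolding Tbar_inner_def sum_distrib_left factors
    by (simp only: length_ks strict_chains_eq_step_chains)
  show ?thesis
  proof (cases "N = 0")
    case True
    then have "?C = {}" by (auto simp: step_chains_def)
    then have "Tbar_inner ks N = 0"
      using inner by (simp only: sum.empty) simp
    then show ?thesis
      using True assms by (simp add: nested_sum_nth_eq_0)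
  next
    case False
    have "(\<Sum>ns\<in>?C. \<Prod>j<Suc r. Tbar_factor ?c j (ns ! j)) =
        (\<Sum>ns\<in>step_chains (\<lambda>_. 1) r (N - 1). \<Prod>j<Suc r. Tbar_factor ?c j ((ns @ [N]) ! j))"
      using False by (subst step_chains_last_eq) (auto simp: sum.reindex inj_on_def)
    also have "\<dots> = Tbar_factor ?c r N * chain_sum (\<lambda>_. 1) (Tbar_factor ?c) r (N - 1)"
      unfolding chain_sum_def sum_distrib_left
      by (intro sum.cong) (auto simp: step_chains_def nth_append)
    also have "\<dots> = nested_sum 1 (ks ! r # rev (map ?c [0..<r])) $ (2 * N - Suc r)"
      unfolding chain_sum_eq_two_step_sum using False by (intro Tbar_factor_mult_two_step_sum) auto
    also have "ks ! r # rev (map ?c [0..<r]) = rev ks"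
      using arg_cong[OF map_nth[of ks], of rev] by (simp add: length_ks)
    finally show ?thesis
      using inner by (simp only: length_ks)
  qed
qed

lemma sums_even_indices_shift:
  fixes a :: "nat \<Rightarrow> real"
  assumes "a sums l" "a 0 = 0" and odd: "\<And>k. odd k \<Longrightarrow> a k = 0"
  shows "(\<lambda>n. a (2 * n - 2 * h)) sums l"
proof -
  have "a k = 0" if "k \<notin> range (\<lambda>n. 2 * n)" for k
    using that by (intro odd) (metis evenE rangeI)
  then have "(\<lambda>n. a (2 * n)) sums l"
    using assms(1) sums_mono_reindex[of "\<lambda>n. 2 * n" a l] by (auto simp: strict_mono_def)
  then have "(\<lambda>n. a (2 * (n + h) - 2 * h)) sums l" by simp
  moreover have "(\<Sum>n<h. a (2 * n - 2 * h)) = 0"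
    using assms(2) by (intro sum.neutral) auto
  ultimately show ?thesis
    using sums_iff_shift[of "\<lambda>n. a (2 * n - 2 * h)" h l] by (simp only: add_0_right)
qed

lemma Tbar_eq_suminf_nested_sum:
  assumes "ks \<noteq> []" "even (length ks)" "\<forall>c\<in>set ks. 0 < c"
  shows "Tbar ks = suminf (($) (nested_sum (-1) (rev ks)))"
proof -
  let ?a = "($) (nested_sum (-1) (rev ks))"
  obtain h where length_ks: "length ks = 2 * h" using assms(2) by (elim evenE)
  have "?a 0 = 0"
    using assms(1) by (intro nested_sum_nth_eq_0) auto
  have "?a (2 * N - 2 * h) = 2 ^ length ks * Tbar_inner ks N" for N
  proof (cases "h \<le> N")
    case True
    then show ?thesis
      unfolding nested_sum_nth_sign[of "rev ks"] Tbar_inner_eq_nested_sum[OF assms(1)]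
      by (simp add: length_ks power_add power_mult)
  next
    case False
    then show ?thesis
      unfolding Tbar_inner_eq_nested_sum[OF assms(1)] using assms(1) \<open>?a 0 = 0\<close>
      by (simp add: length_ks nested_sum_nth_eq_0)
  qed
  moreover have "(\<lambda>n. ?a (2 * n - 2 * h)) sums suminf ?a"
  proof (rule sums_even_indices_shift)
    show "?a sums suminf ?a"
      using assms(3) by (intro summable_sums summable_nested_sum_alternating) auto
    show "?a k = 0" if "odd k" for k
      using that assms(2) by (intro nested_sum_nth_parity) auto
  qed (rule \<open>?a 0 = 0\<close>)
  ultimately have "(\<lambda>N. 2 ^ length ks * Tbar_inner ks N) sums suminf ?a"
    by (simp only:)
  from sums_mult[OF this, of "1 / 2 ^ length ks"] show ?thesis
    by (simp add: Tbar_def sums_iff)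
qed

lemma W_eq_suminf_composition_sum:
  assumes "even r" "0 < r"
  shows "W n r = suminf (($) (composition_sum (-1) r n))"
proof -
  have "W n r = (\<Sum>ks\<in>Icomp n r. suminf (($) (nested_sum (-1) (rev ks))))"
    unfolding W_def using assms by (intro sum.cong Tbar_eq_suminf_nested_sum) (auto simp: Icomp_iff)
  also have "\<dots> = (\<Sum>cs\<in>Icomp n r. suminf (($) (nested_sum (-1) cs)))"
    by (rule sum.reindex_bij_witness[of _ rev rev]) (auto simp: Icomp_iff)
  also have "\<dots> = (\<Sum>k. \<Sum>cs\<in>Icomp n r. nested_sum (-1) cs $ k)"
    by (intro suminf_sum[symmetric] summable_nested_sum_alternating) (auto simp: Icomp_iff)
  finally show ?thesis
    by (simp only: composition_sum_nth)
qed

section \<open>Inversion by Z\<close>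

definition Z_part :: "nat \<Rightarrow> nat \<Rightarrow> nat \<Rightarrow> real" where
  "Z_part k j p =
     (-2) ^ k * (\<Sum>is\<in>Zchains k j p. \<Prod>l=1..k. zetabar (2 * (is ! l) - 2 * (is ! (l - 1))))"

lemma Zchains_0: "Zchains 0 j p = (if j = p then {[j]} else {})"
  by (auto simp: Zchains_def length_Suc_conv)

lemma Zchains_nth_mono: "is \<in> Zchains k j p \<Longrightarrow> a \<le> b \<Longrightarrow> b \<le> k \<Longrightarrow> is ! a \<le> is ! b"
  by (auto simp: Zchains_def strict_sorted_iff intro!: sorted_nth_mono)

lemma Zchains_Suc:
  "Zchains (Suc k) j p = (\<lambda>(i, is). is @ [p]) ` (SIGMA i:{j..<p}. Zchains k j i)"
proof (intro equalityI subsetI)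
  fix ms assume ms_in: "ms \<in> Zchains (Suc k) j p"
  then have "length ms = Suc (Suc k)" by (simp add: Zchains_def)
  then obtain ns l where ns_props: "ms = ns @ [l]" "length ns = Suc k"
    by (metis length_Suc_conv_rev)
  with ms_in have "l = p" "ns ! k < p" "ns \<in> Zchains k j (ns ! k)"
    by (auto simp: Zchains_def sorted_wrt_append nth_append)
  moreover from this have "j \<le> ns ! k"
    using Zchains_nth_mono[of ns k j "ns ! k" 0 k] by (simp add: Zchains_def)
  ultimately show "ms \<in> (\<lambda>(i, is). is @ [p]) ` (SIGMA i:{j..<p}. Zchains k j i)"
    using ns_props(1) by force
next
  fix ms assume "ms \<in> (\<lambda>(i, is). is @ [p]) ` (SIGMA i:{j..<p}. Zchains k j i)"
  then obtain i ns where i_less: "i < p" and ns_props: "ns \<in> Zchains k j i" "ms = ns @ [p]" by auto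
  have "x < p" if x_in: "x \<in> set ns" for x
  proof -
    obtain l where "l \<le> k" "x = ns ! l"
      using x_in ns_props(1) by (auto simp: Zchains_def in_set_conv_nth less_Suc_eq_le)
    then show ?thesis
      using Zchains_nth_mono[OF ns_props(1), of l k] ns_props(1) i_less by (simp add: Zchains_def)
  qed
  then show "ms \<in> Zchains (Suc k) j p"
    using ns_props by (auto simp: Zchains_def sorted_wrt_append nth_append)
qed

lemma finite_Zchains: "finite (Zchains k j p)"
  by (induction k arbitrary: p) (auto simp: Zchains_0 Zchains_Suc)

lemma Z_part_0: "Z_part 0 j p = (if j = p then 1 else 0)"
  by (simp add: Z_part_def Zchains_0)

lemma Z_part_Suc: "Z_part (Suc k) j p = (\<Sum>i=j..<p. - 2 * zetabar (2 * p - 2 * i) * Z_part k j i)"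
proof -
  let ?P = "\<lambda>k is. \<Prod>l=1..k. zetabar (2 * (is ! l) - 2 * (is ! (l - 1)))"
  have "inj_on (\<lambda>(i, is). is @ [p]) (SIGMA i:{j..<p}. Zchains k j i)"
    by (auto simp: inj_on_def Zchains_def)
  then have "(\<Sum>is\<in>Zchains (Suc k) j p. ?P (Suc k) is) =
      (\<Sum>(i, is)\<in>(SIGMA i:{j..<p}. Zchains k j i). ?P (Suc k) (is @ [p]))"
    unfolding Zchains_Suc by (subst sum.reindex) (auto simp: case_prod_unfold)
  also have "\<dots> = (\<Sum>i=j..<p. \<Sum>is\<in>Zchains k j i. ?P (Suc k) (is @ [p]))"
    by (subst sum.Sigma) (auto simp: finite_Zchains)
  also have "\<dots> = (\<Sum>i=j..<p. \<Sum>is\<in>Zchains k j i. zetabar (2 * p - 2 * i) * ?P k is)"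
  proof (intro sum.cong refl)
    fix i "is" assume "is \<in> Zchains k j i"
    then have "length is = Suc k" "is ! k = i" by (auto simp: Zchains_def)
    moreover from this have "?P k (is @ [p]) = ?P k is"
      by (intro prod.cong) (auto simp: nth_append)
    ultimately show "?P (Suc k) (is @ [p]) = zetabar (2 * p - 2 * i) * ?P k is"
      by (simp add: nth_append)
  qed
  finally show ?thesis
    unfolding Z_part_def by (simp add: sum_distrib_left mult_ac)
qed

lemma Z_part_eq_0: "p < j + k \<Longrightarrow> Z_part k j p = 0"
proof (induction k arbitrary: p)
  case (Suc k)
  then show ?case unfolding Z_part_Suc by (intro sum.neutral) auto
qed (simp add: Z_part_0)

lemma Z_eq_sum_Z_part:
  assumes "j \<le> p" "p - j \<le> K"
  shows "Z j p = (\<Sum>k\<le>K. Z_part k j p)"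
proof -
  have "(\<Sum>k\<le>K. Z_part k j p) = (\<Sum>k\<le>p - j. Z_part k j p)"
    using assms by (intro sum.mono_neutral_right) (auto intro!: Z_part_eq_0)
  also have "\<dots> = Z_part 0 j p + (\<Sum>k=1..p - j. Z_part k j p)"
    by (simp add: atMost_atLeast0 sum.atLeast_Suc_atMost)
  also have "\<dots> = Z j p"
    by (auto simp: Z_def Z_part_0) (simp add: Z_part_def)
  finally show ?thesis by simp
qed

lemma Z_rec:
  assumes "j < p"
  shows "Z j p = (\<Sum>i=j..<p. - 2 * zetabar (2 * p - 2 * i) * Z j i)"
proof -
  obtain K where p_eq: "p = Suc K" using assms by (cases p) auto
  have "Z j p = (\<Sum>k\<le>Suc K. Z_part k j p)"
    using assms p_eq by (intro Z_eq_sum_Z_part) auto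
  also have "\<dots> = (\<Sum>k\<le>K. Z_part (Suc k) j p)"
    using assms by (simp add: sum.atMost_Suc_shift Z_part_0 del: sum.atMost_Suc)
  also have "\<dots> = (\<Sum>i=j..<p. - 2 * zetabar (2 * p - 2 * i) * (\<Sum>k\<le>K. Z_part k j i))"
    unfolding Z_part_Suc sum_distrib_left by (rule sum.swap)
  also have "\<dots> = (\<Sum>i=j..<p. - 2 * zetabar (2 * p - 2 * i) * Z j i)"
    using p_eq by (intro sum.cong refl) (subst Z_eq_sum_Z_part[of j _ K], auto)
  finally show ?thesis .
qed

lemma Z_inversion:
  assumes D_eq: "\<And>j. 1 \<le> j \<Longrightarrow> D j = (\<Sum>i=1..j. 2 * zetabar (2 * j - 2 * i) * y i)" and "1 \<le> p"
  shows "y p = (\<Sum>j=1..p. Z j p * D j)"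
  using \<open>1 \<le> p\<close>
proof (induction p rule: less_induct)
  case (less p)
  let ?t = "\<lambda>i j. - 2 * zetabar (2 * p - 2 * i) * (Z j i * D j)"
  have "{1..p} = insert p {1..<p}" using less.prems by auto
  then have split_last: "(\<Sum>i=1..p. f i) = f p + (\<Sum>i=1..<p. f i)" for f :: "nat \<Rightarrow> real"
    by simp
  have "D p = y p + (\<Sum>i=1..<p. 2 * zetabar (2 * p - 2 * i) * y i)"
    unfolding D_eq[OF less.prems] split_last by (simp add: zetabar_def)
  then have "y p = D p + (\<Sum>i=1..<p. - 2 * zetabar (2 * p - 2 * i) * y i)"
    by (simp add: sum_negf)
  also have "(\<Sum>i=1..<p. - 2 * zetabar (2 * p - 2 * i) * y i) =
      (\<Sum>i=1..<p. \<Sum>j | j \<in> {1..<p} \<and> j \<le> i. ?t i j)"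
  proof (rule sum.cong)
    fix i assume i_in: "i \<in> {1..<p}"
    then have "{j. j \<in> {1..<p} \<and> j \<le> i} = {1..i}" by auto
    with i_in less.IH
    show "- 2 * zetabar (2 * p - 2 * i) * y i = (\<Sum>j | j \<in> {1..<p} \<and> j \<le> i. ?t i j)"
      by (simp add: sum_distrib_left)
  qed simp
  also have "\<dots> = (\<Sum>j=1..<p. \<Sum>i | i \<in> {1..<p} \<and> j \<le> i. ?t i j)"
    by (rule sum.swap_restrict) auto
  also have "\<dots> = (\<Sum>j=1..<p. Z j p * D j)"
  proof (rule sum.cong)
    fix j assume j_in: "j \<in> {1..<p}"
    then have "{i. i \<in> {1..<p} \<and> j \<le> i} = {j..<p}" by auto
    with j_in show "(\<Sum>i | i \<in> {1..<p} \<and> j \<le> i. ?t i j) = Z j p * D j"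
      by (simp add: Z_rec sum_distrib_right mult.assoc)
  qed simp
  finally show ?case
    unfolding split_last by (simp add: Z_def)
qed

lemma T_zetabar_conv_eq_sum_T_ones:
  assumes "1 \<le> j"
  shows "T_zetabar_conv (2 * j - 1) (2 * n + 1) =
           (\<Sum>l=1..j. 2 * zetabar (2 * j - 2 * l) * T_ones (Suc n) l)"
proof -
  have "even i" if "i \<in> {..2 * j - 1} - (\<lambda>l. 2 * l - 1) ` {1..j}" for i
  proof (rule ccontr)
    assume "odd i"
    then obtain l where "i = 2 * l + 1" by (elim oddE)
    then show False using that assms by (auto intro!: image_eqI[of _ _ "Suc l"])
  qed
  then have "T_zetabar_conv (2 * j - 1) (2 * n + 1) =
      (\<Sum>i\<in>(\<lambda>l. 2 * l - 1) ` {1..j}. 2 * zetabar (2 * j - 1 - i) * T_fps 1 i $ (2 * n + 1))"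
    unfolding T_zetabar_conv_def
    by (intro sum.mono_neutral_right) (auto simp: T_fps_nth_parity)
  also have "\<dots> =
      (\<Sum>l=1..j. 2 * zetabar (2 * j - 1 - (2 * l - 1)) * T_fps 1 (2 * l - 1) $ (2 * n + 1))"
    by (subst sum.reindex) (auto simp: inj_on_def)
  also have "\<dots> = (\<Sum>l=1..j. 2 * zetabar (2 * j - 2 * l) * T_ones (Suc n) l)"
  proof (rule sum.cong)
    fix l assume "l \<in> {1..j}"
    then have "2 * j - 1 - (2 * l - 1) = 2 * j - 2 * l" "1 \<le> l" by auto
    then show "2 * zetabar (2 * j - 1 - (2 * l - 1)) * T_fps 1 (2 * l - 1) $ (2 * n + 1)
      = 2 * zetabar (2 * j - 2 * l) * T_ones (Suc n) l" by (simp only: T_ones_eq_T_fps)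
  qed simp
  finally show ?thesis .
qed

lemma T_ones_eq_sum_Z:
  assumes "1 \<le> p"
  shows "T_ones (Suc n) p = (\<Sum>j=1..p. Z j p * T_zetabar_conv (2 * j - 1) (2 * n + 1))"
  using T_zetabar_conv_eq_sum_T_ones assms by (rule Z_inversion)

lemma T_fps_alternating_nth_odd:
  assumes "1 \<le> m"
  shows "(-1) ^ m * T_fps (-1) (2 * m - 1) $ (2 * n + 1) = (-1) ^ Suc n * T_ones (Suc n) m"
proof -
  obtain a where m_eq: "m = Suc a" using assms by (cases m) auto
  have exponent: "(2 * n + 1 + (2 * m - 1)) div 2 + (2 * m - 1) = n + m + (2 * a + 1)"
    by (simp add: m_eq)
  have "m + (n + m + (2 * a + 1)) = Suc n + 2 * (m + a)" by simp
  then have "(-1::real) ^ m * (-1) ^ (n + m + (2 * a + 1)) = (-1) ^ Suc n"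
    unfolding power_add[symmetric] by (simp add: power_add power_mult)
  then show ?thesis
    unfolding T_fps_nth_sign[of "2 * m - 1"] T_ones_eq_T_fps[OF assms] exponent
      mult.assoc[symmetric] by (simp only:)
qed

lemma T_ones_mult_T_zetabar_conv_sums:
  assumes "1 \<le> m" "1 \<le> j"
  shows "(\<lambda>n. (-1) ^ Suc n * T_ones (Suc n) m
             * (T_zetabar_conv (2 * j - 1) (2 * n + 1) / real (Suc n)))
           sums ((-1) ^ m * W (2 * j + 2 * m - 1) (2 * m))"
proof -
  define a where "a k =
    T_fps (-1) (2 * m - 1) $ k * (2 / real (Suc k)) * T_zetabar_conv (2 * j - 1) k" for k
  have "a sums suminf (($) (composition_sum (-1) (Suc (2 * m - 1)) (2 * j - 1 + Suc (2 * m - 1))))"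
    unfolding a_def using assms by (intro T_fps_mult_T_zetabar_conv_sums) auto
  moreover have "Suc (2 * m - 1) = 2 * m" "2 * j - 1 + 2 * m = 2 * j + 2 * m - 1"
    using assms by auto
  ultimately have "a sums W (2 * j + 2 * m - 1) (2 * m)"
    using assms by (simp add: W_eq_suminf_composition_sum)
  moreover have "a k = 0" if "k \<notin> range (\<lambda>n. 2 * n + 1)" for k
  proof -
    have "even k" using that by (metis oddE rangeI)
    then show ?thesis using assms by (simp add: a_def T_fps_nth_parity)
  qed
  ultimately have "(\<lambda>n. a (2 * n + 1)) sums W (2 * j + 2 * m - 1) (2 * m)"
    using sums_mono_reindex[of "\<lambda>n. 2 * n + 1" a] by (auto simp: strict_mono_def)
  then have "(\<lambda>n. (-1) ^ m * a (2 * n + 1)) sums ((-1) ^ m * W (2 * j + 2 * m - 1) (2 * m))"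
    by (rule sums_mult)
  moreover have "(-1) ^ m * a (2 * n + 1) =
      (-1) ^ Suc n * T_ones (Suc n) m
        * (T_zetabar_conv (2 * j - 1) (2 * n + 1) / real (Suc n))" for n
    unfolding T_fps_alternating_nth_odd[OF assms(1), symmetric] by (simp add: a_def field_simps)
  ultimately show ?thesis by (simp only:)
qed

theorem mainTheorem8:
  fixes m p :: nat
  assumes "1 \<le> m" and "1 \<le> p"
  shows "(\<lambda>n. T_ones (Suc n) m * T_ones (Suc n) p / real (Suc n) * (-1)^(Suc n))
           sums ((-1)^m * (\<Sum>j=1..p. W (2*j + 2*m - 1) (2*m) * Z j p))"
proof -
  let ?D = "\<lambda>j n. T_zetabar_conv (2 * j - 1) (2 * n + 1)"
  have "(\<lambda>n. \<Sum>j=1..p. Z j p * ((-1) ^ Suc n * T_ones (Suc n) m * (?D j n / real (Suc n))))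
      sums (\<Sum>j=1..p. Z j p * ((-1) ^ m * W (2 * j + 2 * m - 1) (2 * m)))"
    using assms by (intro sums_sum sums_mult T_ones_mult_T_zetabar_conv_sums) auto
  moreover have "(\<Sum>j=1..p. Z j p * ((-1) ^ Suc n * T_ones (Suc n) m * (?D j n / real (Suc n)))) =
      T_ones (Suc n) m * T_ones (Suc n) p / real (Suc n) * (-1) ^ Suc n" for n
    unfolding T_ones_eq_sum_Z[OF assms(2)] sum_distrib_left sum_distrib_right sum_divide_distrib
    by (intro sum.cong) (simp_all add: mult_ac)
  moreover have "(\<Sum>j=1..p. Z j p * ((-1) ^ m * W (2 * j + 2 * m - 1) (2 * m)))
      = (-1) ^ m * (\<Sum>j=1..p. W (2 * j + 2 * m - 1) (2 * m) * Z j p)"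
    by (simp add: sum_distrib_left mult_ac)
  ultimately show ?thesis by (simp only:)
qed

end
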